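(* Let $(u_0^{(j)})_{j=1,\dots,J}$ be an initial particle system with $h_i(\bar u_0)<0$ for all $i=1,\dots,m$ and $\|u_0^{(j)}\|\le c$ for all $j=1,\dots,J$ and some $c>0$. Assume that the feasible set is bounded, i.e. there exists $R>0$ such that $\Omega\subseteq\mathcal B_R(0)$, and that $\|\nabla h_i(u)\|\le C(R)$ for some constant $C(R)>0$ depending on $R$, all $u\in\mathcal B_R(0)$ and all $i=1,\dots,m$. Then the mean of any solution $(u_t^{(j)},t\ge0)$, $j=1,\dots,J$, of the inflated constrained EKI flow remains in the feasible set, i.e. $\bar u_t\in\Omega$ for all $t\ge0$. Moreover, there exists a unique (global in time) solution of the inflated constrained EKI flow.
   Context: Setting: $X=\mathbb{R}^d$, $G:X\to\mathbb{R}^K$ is a (possibly nonlinear) forward map, locally Lipschitz continuous with constant $c_{lip}>0$ (every point of $X$ has a neighbourhood on which $G$ is Lipschitz with constant $c_{lip}$), and there is $b_{res}$ such that $G(x_1)=G(x_2)+DG(x_2)(x_1-x_2)+Res(x_1,x_2)$ with $\|Res(x_1,x_2)\|\le b_{res}\|x_1-x_2\|^2$ for all $x_1,x_2\in X$; $y\in\mathbb{R}^K$ is given data, $\Gamma\in\mathbb{R}^{K\times K}$ and $C_0\in\mathbb{R}^{d\times d}$ are symmetric positive definite. $\Omega=\{u\in X: h_i(u)\le0,\ i=1,\dots,m\}$, where each $h_i:X\to\mathbb{R}$ is convex and continuously differentiable and there exists $u\in X$ with $h_i(u)<0$ for all $i$. $\tau>0$ is a penalty parameter, $\|\cdot\|$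 is the Euclidean norm and $\mathcal B_R(0)$ is the ball of radius $R$ around $0$. Ensemble notation: for particles $u_t=(u_t^{(j)})_{j=1,\dots,J}$ in $X$, $J\ge2$, put $\bar u_t=\frac1J\sum_j u_t^{(j)}$, $\bar G(u_t)=\frac1J\sum_jG(u_t^{(j)})$, $\widehat C(u_t)=\frac1J\sum_j(u_t^{(j)}-\bar u_t)(u_t^{(j)}-\bar u_t)^T$, $\widehat C_t^{u,G}=\frac1J\sum_j(u_t^{(j)}-\bar u_t)(G(u_t^{(j)})-\bar G(u_t))^T$. Inflated constrained EKI flow: for $j=1,\dots,J$, with initial state $(u_0^{(j)})_{j=1,\dots,J}$, $$\frac{\mathrm{d}u_t^{(j)}}{\mathrm{d}t}=-\widehat C_t^{u,G}\Gamma^{-1}(G(u_t^{(j)})-y)-\widehat C(u_t)C_0^{-1}u_t^{(j)}+\rho_t\,\widehat C_t^{u,G}\Gamma^{-1}(G(u_t^{(j)})-\bar G(u_t))+\frac1\tau\widehat C(u_t)\sum_{i=1}^m\frac{1}{h_i(\bar u_t)}\nabla h_i(\bar u_t),$$ where the covariance inflation factor satisfies $0\le\rho_t\le1$ for all $t\ge0$ and $\rho_t\to1$ as $t\to\infty$.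
   Formalization: The covariance inflation factor ρ_t is additionally assumed continuous in t on [0,∞); without this, e.g. for a ρ with a jump, a classical solution of the flow need not exist. *)

theory Defs
  imports "HOL-Analysis.Analysis"
begin

definition spd :: "real^'n^'n \<Rightarrow> bool" where
  "spd A \<longleftrightarrow> transpose A = A \<and> (\<forall>x. x \<noteq> 0 \<longrightarrow> 0 < x \<bullet> (A *v x))"

definition grad :: "('a::real_inner \<Rightarrow> real) \<Rightarrow> 'a \<Rightarrow> 'a" where
  "grad f x = (THE D. GDERIV f x :> D)"

definition cont_diff :: "('a::real_inner \<Rightarrow> real) \<Rightarrow> bool" where
  "cont_diff f \<longleftrightarrow> (\<forall>x. GDERIV f x :> grad f x) \<and> continuous_on UNIV (grad f)"

definition loc_lipschitz :: "real \<Rightarrow> ('a::metric_space \<Rightarrow> 'b::metric_space) \<Rightarrow> bool" where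
  "loc_lipschitz L f \<longleftrightarrow> (\<forall>x. \<exists>U. open U \<and> x \<in> U \<and> L-lipschitz_on U f)"

text \<open>An ensemble of J particles is a vector indexed by a finite type \<open>'j\<close> with
  \<open>CARD('j) = J\<close>; likewise the constraints are indexed by a finite type \<open>'m\<close>.\<close>

definition ens_mean :: "('a::real_vector)^'j \<Rightarrow> 'a" where
  "ens_mean u = (1 / real CARD('j)) *\<^sub>R (\<Sum>j\<in>UNIV. u $ j)"

definition ens_image :: "('a \<Rightarrow> 'b) \<Rightarrow> 'a^'j \<Rightarrow> 'b^'j" where
  "ens_image G u = (\<chi> j. G (u $ j))"

definition outer :: "real^'n \<Rightarrow> real^'k \<Rightarrow> real^'k^'n" where
  "outer v w = (\<chi> a b. v $ a * w $ b)"

definition ens_cross_cov :: "(real^'n)^'j \<Rightarrow> (real^'k)^'j \<Rightarrow> real^'k^'n" where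
  "ens_cross_cov u v =
     (1 / real CARD('j)) *\<^sub>R (\<Sum>j\<in>UNIV. outer (u $ j - ens_mean u) (v $ j - ens_mean v))"

definition ens_cov :: "(real^'n)^'j \<Rightarrow> real^'n^'n" where
  "ens_cov u = ens_cross_cov u u"

definition feasible :: "('m \<Rightarrow> 'a \<Rightarrow> real) \<Rightarrow> 'a set" where
  "feasible h = {u. \<forall>i. h i u \<le> 0}"

text \<open>Right-hand side for particle \<open>j\<close>, with \<open>r\<close> the current value of the inflation factor.
  The barrier term is meaningful only where \<open>h i (ens_mean u) \<noteq> 0\<close> for all \<open>i\<close>; elsewhere HOL's
  \<open>1 / 0 = 0\<close> drops the offending summands.\<close>

definition eki_rhs ::
  "(real^'d \<Rightarrow> real^'k) \<Rightarrow> real^'k \<Rightarrow> real^'k^'k \<Rightarrow> real^'d^'d \<Rightarrow> ('m::finite \<Rightarrow> real^'d \<Rightarrow> real)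
    \<Rightarrow> real \<Rightarrow> real \<Rightarrow> (real^'d)^'j \<Rightarrow> 'j \<Rightarrow> real^'d" where
  "eki_rhs G y \<Gamma> C0 h \<tau> r u j =
     - (ens_cross_cov u (ens_image G u) *v (matrix_inv \<Gamma> *v (G (u $ j) - y)))
     - ens_cov u *v (matrix_inv C0 *v (u $ j))
     + r *\<^sub>R (ens_cross_cov u (ens_image G u) *v
              (matrix_inv \<Gamma> *v (G (u $ j) - ens_mean (ens_image G u))))
     + (1 / \<tau>) *\<^sub>R (ens_cov u *v
              (\<Sum>i\<in>UNIV. (1 / h i (ens_mean u)) *\<^sub>R grad (h i) (ens_mean u)))"

text \<open>Global classical solutions; the derivative at \<open>t = 0\<close> is one-sided. It is deliberately not
  required here that \<open>h i (ens_mean (u t)) \<noteq> 0\<close>: by continuity in \<open>t\<close> such a requirement would by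
  itself confine the mean of a solution to the feasible set.\<close>

definition eki_solution ::
  "(real^'d \<Rightarrow> real^'k) \<Rightarrow> real^'k \<Rightarrow> real^'k^'k \<Rightarrow> real^'d^'d \<Rightarrow> ('m::finite \<Rightarrow> real^'d \<Rightarrow> real)
    \<Rightarrow> real \<Rightarrow> (real \<Rightarrow> real) \<Rightarrow> (real^'d)^'j \<Rightarrow> (real \<Rightarrow> (real^'d)^'j) \<Rightarrow> bool" where
  "eki_solution G y \<Gamma> C0 h \<tau> \<rho> u0 u \<longleftrightarrow>
     u 0 = u0 \<and>
     (\<forall>t\<ge>0. \<forall>j. ((\<lambda>s. u s $ j) has_vector_derivative eki_rhs G y \<Gamma> C0 h \<tau> (\<rho> t) (u t) j)
                  (at t within {0..}))"

end

theory Submission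
  imports Defs "HOL-Complex_Analysis.Great_Picard"
begin

text \<open>Write \<open>m\<close> for the ensemble mean, \<open>e\<^sub>j\<close> for the deviation of particle \<open>j\<close> from it, \<open>C\<close> for the ensemble
covariance and \<open>\<Phi> = \<Sum>\<^sub>i \<nabla>h\<^sub>i / h\<^sub>i\<close>, which is the gradient of \<open>\<Sum>\<^sub>i ln (- h\<^sub>i)\<close>. Every term of the
right-hand side is a linear combination of deviations, and the barrier term is the same for all
particles. Hence the flow splits into
\<open>m' = C \<Phi>(m) / \<tau> - drift\<close> and \<open>e\<^sub>j' = - (1/J) \<Sum>\<^sub>k c\<^sub>j\<^sub>k e\<^sub>k\<close>, where the coefficients \<open>c\<^sub>j\<^sub>k\<close> are a sum of
two Gram matrices, one of them weighted with \<open>1 - \<rho> \<ge> 0\<close> (\<open>eki_rhs_decomposition\<close>).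

Invariance of the feasible set. Since the Gram matrices are positive semidefinite,
\<open>\<Sum>\<^sub>j |e\<^sub>j|\<^sup>2\<close> does not increase, wherever the mean goes (\<open>deviation_energy_nonincreasing\<close>). While the
mean is strictly feasible it lies in the bounded feasible set, so the whole ensemble is bounded.
With \<open>s\<^sub>k = e\<^sub>k \<bullet> \<Phi>(m)\<close> and \<open>a\<^sub>k\<close> the coefficients of the drift,
\<open>(\<Sum>\<^sub>i ln (- h\<^sub>i(m)))' = (1/J) \<Sum>\<^sub>k (s\<^sub>k\<^sup>2 / \<tau> - a\<^sub>k s\<^sub>k) \<ge> - \<tau> (max \<bar>a\<^sub>k\<bar>)\<^sup>2 / 4\<close>:
the repulsion of the barrier is quadratic in the quantities \<open>s\<^sub>k\<close> in which the drift is only linear.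
So \<open>\<Sum>\<^sub>i ln (- h\<^sub>i(m))\<close> decreases at most linearly in time and, as each \<open>- h\<^sub>i\<close> is bounded above on the
feasible set, every \<open>- h\<^sub>i(m)\<close> keeps a positive distance from \<open>0\<close> on each bounded time interval
(\<open>flow_a_priori_bounds\<close>). A first time at which the mean is not strictly feasible cannot exist.

Uniqueness. The gradients of the \<open>h\<^sub>i\<close> are merely continuous, so the vector field need not be
Lipschitz. But \<open>- \<Phi>\<close> is the gradient of a convex function, whence
\<open>(\<Phi>(a) - \<Phi>(b)) \<bullet> (a - b) \<le> 0\<close>. For two solutions with mean difference \<open>\<Delta>\<close> one therefore follows
\<open>\<Delta> \<bullet> C\<^sup>-\<^sup>1 \<Delta>\<close>, in whose derivative the preconditioner \<open>C\<close> of the barrier cancels and the barrier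
contributes a nonpositive term, while all other terms are Lipschitz; Gronwall's inequality concludes
(\<open>flow_unique\<close>). The covariance may be singular, for instance when there are fewer particles than
dimensions. It is invertible on the span of the deviations, which does not depend on time because
the deviations solve a linear system (\<open>deviations_orthogonal_iff\<close>) and which contains \<open>\<Delta>\<close>; so
\<open>C\<close> is completed by a constant matrix acting on the orthogonal complement of this span.

Existence. Peano's theorem is applied on \<open>[0, T]\<close> to a bounded continuous field that agrees with the
right-hand side where \<open>|u| \<le> M\<close> and all \<open>h\<^sub>i(m) \<le> - \<delta>\<close>; the a priori bounds show that its solution
never leaves this region (\<open>flow_exists\<close>). By uniqueness the solutions for different \<open>T\<close> fit together.\<close>

section \<open>First exits and differential inequalities\<close>

text \<open>The times at which the curve is outside an open set form a closed set, so there would be a first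
one. This turns an estimate that is valid up to time \<open>b\<close> whenever the curve was in \<open>U\<close> before \<open>b\<close> into an
unconditional statement; the case \<open>b = 0\<close> of the hypothesis is the initial condition.\<close>

lemma continuous_no_first_exit:
  fixes g :: "real \<Rightarrow> 'a::topological_space"
  assumes cont: "continuous_on {0..T} g" and "open U"
    and step: "\<And>b. 0 \<le> b \<Longrightarrow> b \<le> T \<Longrightarrow> (\<And>t. 0 \<le> t \<Longrightarrow> t < b \<Longrightarrow> g t \<in> U) \<Longrightarrow> g b \<in> U"
    and t: "0 \<le> t" "t \<le> T"
  shows "g t \<in> U"
proof (rule ccontr)
  assume "g t \<notin> U"
  define D where "D = {0..T} \<inter> g -` (- U)"
  have "closed D"
    unfolding D_def using cont \<open>open U\<close> by (intro continuous_closed_preimage) auto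
  moreover have "bounded D"
    unfolding D_def by (rule bounded_subset[OF bounded_closed_interval]) (rule Int_lower1)
  ultimately have "compact D" by (simp add: compact_eq_bounded_closed)
  moreover have "D \<noteq> {}" using \<open>g t \<notin> U\<close> t by (auto simp: D_def)
  ultimately obtain b where b: "b \<in> D" "\<forall>s\<in>D. b \<le> s"
    using compact_attains_inf[of D] by metis
  have "g s \<in> U" if "0 \<le> s" "s < b" for s
    using b that by (force simp: D_def)
  then have "g b \<in> U" using step[of b] b(1) by (auto simp: D_def)
  with b(1) show False by (simp add: D_def)
qed

lemma nonincreasing_of_deriv_nonpos:
  fixes Z :: "real \<Rightarrow> real"
  assumes Z: "\<And>t. t \<in> {a..b} \<Longrightarrow> (Z has_real_derivative Z' t) (at t within {a..b})"
    and le: "\<And>t. a < t \<Longrightarrow> t < b \<Longrightarrow> Z' t \<le> 0"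
    and st: "a \<le> s" "s \<le> t" "t \<le> b"
  shows "Z t \<le> Z s"
proof -
  have cont: "continuous_on {a..b} Z"
    using Z by (meson DERIV_continuous continuous_on_eq_continuous_within)
  show ?thesis
  proof (rule DERIV_nonpos_imp_decreasing_open[OF st(2)])
    fix x assume x: "s < x" "x < t"
    then have "(Z has_real_derivative Z' x) (at x)"
      using Z[of x] st at_within_Icc_at[of a x b] by auto
    then show "\<exists>y. DERIV Z x :> y \<and> y \<le> 0" using le[of x] x st by auto
  qed (use st in \<open>auto intro: continuous_on_subset[OF cont]\<close>)
qed

lemma gronwall_forward:
  fixes Z :: "real \<Rightarrow> real"
  assumes Z: "\<And>t. t \<in> {0..T} \<Longrightarrow> (Z has_real_derivative Z' t) (at t within {0..T})"
    and le: "\<And>t. t \<in> {0..T} \<Longrightarrow> Z' t \<le> L * Z t"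
    and st: "0 \<le> s" "s \<le> t" "t \<le> T"
  shows "Z t \<le> Z s * exp (L * (t - s))"
proof -
  have "exp (- L * t) * Z t \<le> exp (- L * s) * Z s"
  proof (rule nonincreasing_of_deriv_nonpos[where a = 0 and b = T and Z = "\<lambda>t. exp (- L * t) * Z t" and
        Z' = "\<lambda>t. exp (- L * t) * (Z' t - L * Z t)"])
    show "((\<lambda>t. exp (- L * t) * Z t) has_real_derivative exp (- L * r) * (Z' r - L * Z r))
        (at r within {0..T})" if "r \<in> {0..T}" for r
      using Z[OF that] by (auto intro!: derivative_eq_intros simp: algebra_simps)
    show "exp (- L * r) * (Z' r - L * Z r) \<le> 0" if "0 < r" "r < T" for r
      using le[of r] that by (auto simp: mult_le_0_iff)
  qed (use st in auto)
  then have "exp (L * t) * (exp (- L * t) * Z t) \<le> exp (L * t) * (exp (- L * s) * Z s)"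
    by (intro mult_left_mono) auto
  moreover have "exp (L * t) * exp (- L * t) = 1"
    by (simp add: exp_minus)
  moreover have "exp (L * (t - s)) = exp (L * t) * exp (- L * s)"
    by (simp add: exp_add[symmetric] right_diff_distrib)
  ultimately show ?thesis by (metis mult.assoc mult.commute mult_1)
qed

text \<open>Together with the forward inequality this shows that a nonnegative quantity with
\<open>\<bar>Z'\<bar> \<le> L Z\<close> vanishes either at all times or at none.\<close>

lemma gronwall_backward:
  fixes Z :: "real \<Rightarrow> real"
  assumes Z: "\<And>t. t \<in> {0..T} \<Longrightarrow> (Z has_real_derivative Z' t) (at t within {0..T})"
    and le: "\<And>t. t \<in> {0..T} \<Longrightarrow> - (L * Z t) \<le> Z' t"
    and st: "0 \<le> s" "s \<le> t" "t \<le> T"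
  shows "Z s * exp (- L * (t - s)) \<le> Z t"
proof -
  have "- Z t \<le> - Z s * exp (- L * (t - s))"
  proof (rule gronwall_forward[where T = T and Z' = "\<lambda>t. - Z' t"])
    show "((\<lambda>t. - Z t) has_real_derivative - Z' r) (at r within {0..T})" if "r \<in> {0..T}" for r
      using Z[OF that] by (auto intro!: derivative_eq_intros)
    show "- Z' r \<le> - L * - Z r" if "r \<in> {0..T}" for r using le[OF that] by simp
  qed (use st in auto)
  then show ?thesis by simp
qed

lemma has_real_derivative_inner:
  assumes "(f has_vector_derivative f') (at t within S)" "(g has_vector_derivative g') (at t within S)"
  shows "((\<lambda>s. f s \<bullet> g s) has_real_derivative (f t \<bullet> g' + f' \<bullet> g t)) (at t within S)"
  using bounded_bilinear.has_vector_derivative[OF bounded_bilinear_inner assms]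
  by (simp add: has_real_derivative_iff_has_vector_derivative)

section \<open>Peano's existence theorem\<close>

lemma continuous_on_along:
  assumes cont: "continuous_on (S \<times> UNIV) (\<lambda>(t, x). f t x)" and w: "continuous_on S w"
  shows "continuous_on S (\<lambda>t. f t (w t))"
proof -
  have "continuous_on S (\<lambda>t. (\<lambda>(t, x). f t x) (t, w t))"
    by (rule continuous_on_compose2[OF cont]) (use w in \<open>auto intro!: continuous_on_Pair continuous_on_id\<close>)
  then show ?thesis by simp
qed

text \<open>In Tonelli's delayed equation the value at \<open>t\<close> depends only on values up to \<open>t - \<epsilon>\<close>. The Picard
iterates, started at a constant, are therefore exact on \<open>[0, k \<epsilon>]\<close> after \<open>k\<close> steps, and finitely many
steps solve the equation on \<open>[0, T]\<close>.\<close>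

lemma delay_equation_solvable:
  fixes f :: "real \<Rightarrow> 'a::euclidean_space \<Rightarrow> 'a"
  assumes cont: "continuous_on ({0..T} \<times> UNIV) (\<lambda>(t, x). f t x)" and "\<epsilon> > 0"
  shows "\<exists>u. continuous_on {0..T} u \<and>
    (\<forall>t\<in>{0..T}. u t = x0 + integral {0..t} (\<lambda>s. f s (u (max 0 (s - \<epsilon>)))))"
proof -
  define P where "P v = (\<lambda>t. x0 + integral {0..t} (\<lambda>s. f s (v (max 0 (s - \<epsilon>)))))"
    for v :: "real \<Rightarrow> 'a"
  define v where "v k = (P ^^ k) (\<lambda>_. x0)" for k
  have v_Suc: "v (Suc k) = P (v k)" for k by (simp add: v_def)
  have v_cont: "continuous_on {0..T} (v k)" for k
  proof (induction k)
    case (Suc k)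
    have "continuous_on {0..T} (\<lambda>s. v k (max 0 (s - \<epsilon>)))"
      by (rule continuous_on_compose2[OF Suc])
        (use \<open>\<epsilon> > 0\<close> in \<open>auto intro!: continuous_on_max continuous_on_diff continuous_on_const continuous_on_id\<close>)
    then have "continuous_on {0..T} (\<lambda>s. f s (v k (max 0 (s - \<epsilon>))))"
      by (rule continuous_on_along[OF cont])
    then have "continuous_on {0..T} (\<lambda>t. integral {0..t} (\<lambda>s. f s (v k (max 0 (s - \<epsilon>)))))"
      by (intro indefinite_integral_continuous_1 integrable_continuous_real)
    then show ?case unfolding v_Suc P_def by (intro continuous_intros)
  qed (simp add: v_def)
  have stable: "v (Suc k) t = v k t" if "0 \<le> t" "t \<le> real k * \<epsilon>" for k t
    using that
  proof (induction k arbitrary: t)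
    case (Suc k)
    have "v (Suc k) (max 0 (s - \<epsilon>)) = v k (max 0 (s - \<epsilon>))" if "s \<in> {0..t}" for s
      using that Suc.prems by (intro Suc.IH) (auto simp: algebra_simps max_def)
    then have "integral {0..t} (\<lambda>s. f s (v (Suc k) (max 0 (s - \<epsilon>))))
        = integral {0..t} (\<lambda>s. f s (v k (max 0 (s - \<epsilon>))))"
      by (intro Henstock_Kurzweil_Integration.integral_cong) simp
    then have "P (v (Suc k)) t = P (v k) t" unfolding P_def by simp
    then show ?case using v_Suc by metis
  qed (simp add: v_def P_def)
  obtain k where k: "T / \<epsilon> \<le> real k" using real_arch_simple by blast
  have "T \<le> real k * \<epsilon>" using k \<open>\<epsilon> > 0\<close> by (simp add: pos_divide_le_eq)
  then have "v k t = P (v k) t" if "t \<in> {0..T}" for t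
    using stable[of t k] that by (simp add: v_Suc)
  then show ?thesis using v_cont[of k] unfolding P_def by blast
qed

text \<open>The solutions of the equations with delay \<open>1 / (n + 1)\<close> share the Lipschitz constant \<open>B\<close>. By the
theorem of Arzela and Ascoli a subsequence converges uniformly, and by dominated convergence the
limit satisfies the integral equation without delay.\<close>

theorem peano_existence:
  fixes f :: "real \<Rightarrow> 'a::euclidean_space \<Rightarrow> 'a"
  assumes cont: "continuous_on ({0..T} \<times> UNIV) (\<lambda>(t, x). f t x)"
    and bound: "\<And>t x. t \<in> {0..T} \<Longrightarrow> norm (f t x) \<le> B"
    and "0 \<le> T"
  shows "\<exists>u. u 0 = x0 \<and> (\<forall>t\<in>{0..T}. (u has_vector_derivative f t (u t)) (at t within {0..T}))"
proof -
  have "B \<ge> 0" using order_trans[OF norm_ge_zero bound[of 0 0]] \<open>0 \<le> T\<close> by simp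
  define \<epsilon> where "\<epsilon> n = inverse (real (Suc n))" for n
  have "\<epsilon> n > 0" for n by (simp add: \<epsilon>_def)
  then have "\<forall>n. \<exists>u. continuous_on {0..T} u \<and>
    (\<forall>t\<in>{0..T}. u t = x0 + integral {0..t} (\<lambda>s. f s (u (max 0 (s - \<epsilon> n)))))"
    by (intro allI delay_equation_solvable[OF cont])
  from choice[OF this] obtain F where F_all: "\<forall>n. continuous_on {0..T} (F n) \<and>
    (\<forall>t\<in>{0..T}. F n t = x0 + integral {0..t} (\<lambda>s. f s (F n (max 0 (s - \<epsilon> n)))))" ..
  have F_cont: "continuous_on {0..T} (F n)" for n using F_all by simp
  have F: "F n t = x0 + integral {0..t} (\<lambda>s. f s (F n (max 0 (s - \<epsilon> n))))"
    if "t \<in> {0..T}" for n t using F_all that by blast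
  have f_cont: "continuous_on {0..T} (\<lambda>s. f s (w s))" if "continuous_on {0..T} w" for w
    by (rule continuous_on_along[OF cont that])
  have delay_cont: "continuous_on {0..T} (\<lambda>s. F n (max 0 (s - \<epsilon> n)))" for n
    by (rule continuous_on_compose2[OF F_cont])
      (use \<open>\<epsilon> n > 0\<close> in \<open>auto intro!: continuous_on_max continuous_on_diff continuous_on_const continuous_on_id\<close>)
  have Lip: "norm (F n t - F n s) \<le> B * \<bar>t - s\<bar>" if "s \<in> {0..T}" "t \<in> {0..T}" for n s t
    using that
  proof (induction s t rule: linorder_wlog)
    case (le s t)
    let ?g = "\<lambda>r. f r (F n (max 0 (r - \<epsilon> n)))"
    have int: "?g integrable_on {a..b}" if "0 \<le> a" "b \<le> T" for a b
      using that by (intro integrable_continuous_real continuous_on_subset[OF f_cont[OF delay_cont]]) auto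
    have "F n t - F n s = integral {s..t} ?g"
    proof -
      have "integral {0..s} ?g + integral {s..t} ?g = integral {0..t} ?g"
        using le by (intro Henstock_Kurzweil_Integration.integral_combine int) auto
      then have "integral {s..t} ?g = integral {0..t} ?g - integral {0..s} ?g"
        by (simp add: eq_diff_eq add.commute)
      then show ?thesis using F[of t n] F[of s n] le by simp
    qed
    moreover have "norm (integral {s..t} ?g) \<le> B * (t - s)"
    proof (rule integral_bound)
      show "continuous_on {s..t} ?g"
        by (rule continuous_on_subset[OF f_cont[OF delay_cont]]) (use le in auto)
    qed (use le in \<open>auto intro!: bound\<close>)
    ultimately show ?case using le by simp
  qed (simp add: norm_minus_commute abs_minus_commute)
  have F0: "F n 0 = x0" for n using F[of 0 n] \<open>0 \<le> T\<close> by simp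
  have F_bd: "norm (F n t) \<le> norm x0 + B * T" if "t \<in> {0..T}" for n t
  proof -
    have "norm (F n t) \<le> norm (F n 0) + norm (F n t - F n 0)"
      by (rule norm_triangle_sub)
    also have "\<dots> \<le> norm x0 + B * T"
      using order_trans[OF Lip[of 0 t n] mult_left_mono[of "\<bar>t - 0\<bar>" T B]] that \<open>B \<ge> 0\<close>
      by (simp add: F0)
    finally show ?thesis .
  qed
  obtain g k where g_cont: "continuous_on {0..T} g" and k: "strict_mono (k :: nat \<Rightarrow> nat)"
    and lim: "\<And>e. 0 < e \<Longrightarrow> \<exists>N. \<forall>n x. n \<ge> N \<and> x \<in> {0..T} \<longrightarrow> norm (F (k n) x - g x) < e"
  proof (rule Arzela_Ascoli[of "{0..T}" F "norm x0 + B * T"])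
    show "\<exists>d>0. \<forall>n y. y \<in> {0..T} \<and> norm (x - y) < d \<longrightarrow> norm (F n x - F n y) < e"
      if "x \<in> {0..T}" "0 < e" for x e
    proof (intro exI conjI allI impI)
      show "0 < e / (B + 1)" using \<open>B \<ge> 0\<close> that by simp
      fix n y assume y: "y \<in> {0..T} \<and> norm (x - y) < e / (B + 1)"
      have "norm (F n x - F n y) \<le> B * \<bar>x - y\<bar>" using Lip y that by blast
      also have "\<dots> \<le> (B + 1) * \<bar>x - y\<bar>" by (simp add: algebra_simps)
      also have "\<dots> < e" using y \<open>B \<ge> 0\<close> by (simp add: field_simps)
      finally show "norm (F n x - F n y) < e" .
    qed
  qed (use F_bd in auto)
  have F_lim: "(\<lambda>n. F (k n) t) \<longlonglongrightarrow> g t" if "t \<in> {0..T}" for t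
    unfolding LIMSEQ_iff
  proof (intro allI impI)
    fix e :: real assume "e > 0"
    from lim[OF this] that show "\<exists>no. \<forall>n\<ge>no. norm (F (k n) t - g t) < e" by blast
  qed
  have \<epsilon>_lim: "(\<lambda>n. \<epsilon> (k n)) \<longlonglongrightarrow> 0"
    using LIMSEQ_subseq_LIMSEQ[OF LIMSEQ_inverse_real_of_nat k] by (simp add: \<epsilon>_def o_def)
  \<comment> \<open>The delays tend to zero and the functions are equi-Lipschitz, so delayed values have the same limit.\<close>
  have delay_lim: "(\<lambda>n. F (k n) (max 0 (s - \<epsilon> (k n)))) \<longlonglongrightarrow> g s" if "s \<in> {0..T}" for s
  proof -
    have "(\<lambda>n. F (k n) (max 0 (s - \<epsilon> (k n))) - F (k n) s) \<longlonglongrightarrow> 0"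
    proof (rule Lim_null_comparison)
      show "\<forall>\<^sub>F n in sequentially. norm (F (k n) (max 0 (s - \<epsilon> (k n))) - F (k n) s) \<le> B * \<epsilon> (k n)"
      proof (rule always_eventually, rule allI)
        fix n
        have "norm (F (k n) (max 0 (s - \<epsilon> (k n))) - F (k n) s) \<le> B * \<bar>max 0 (s - \<epsilon> (k n)) - s\<bar>"
          using that \<open>\<epsilon> (k n) > 0\<close> by (intro Lip) auto
        also have "\<dots> \<le> B * \<epsilon> (k n)"
          using that \<open>\<epsilon> (k n) > 0\<close> \<open>B \<ge> 0\<close> by (intro mult_left_mono) (auto simp: max_def)
        finally show "norm (F (k n) (max 0 (s - \<epsilon> (k n))) - F (k n) s) \<le> B * \<epsilon> (k n)" .
      qed
      show "(\<lambda>n. B * \<epsilon> (k n)) \<longlonglongrightarrow> 0" using tendsto_mult_right_zero[OF \<epsilon>_lim] .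
    qed
    from tendsto_add[OF this F_lim[OF that]] show ?thesis by simp
  qed
  have eq: "g t = x0 + integral {0..t} (\<lambda>s. f s (g s))" if t: "t \<in> {0..T}" for t
  proof -
    have "(\<lambda>n. integral {0..t} (\<lambda>s. f s (F (k n) (max 0 (s - \<epsilon> (k n))))))
        \<longlonglongrightarrow> integral {0..t} (\<lambda>s. f s (g s))"
    proof (rule dominated_convergence(2)[where h = "\<lambda>_. B"])
      show "(\<lambda>s. f s (F (k n) (max 0 (s - \<epsilon> (k n))))) integrable_on {0..t}" for n
        using t by (intro integrable_continuous_real continuous_on_subset[OF f_cont[OF delay_cont]]) auto
      show "norm (f s (F (k n) (max 0 (s - \<epsilon> (k n))))) \<le> B" if "s \<in> {0..t}" for n s
        using that t by (intro bound) auto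
      show "(\<lambda>n. f s (F (k n) (max 0 (s - \<epsilon> (k n))))) \<longlonglongrightarrow> f s (g s)" if "s \<in> {0..t}" for s
      proof -
        have s: "s \<in> {0..T}" using that t by auto
        have "continuous_on UNIV (\<lambda>x. (\<lambda>(t, x). f t x) (s, x))"
          by (rule continuous_on_compose2[OF cont continuous_on_Pair[OF continuous_on_const continuous_on_id]])
            (use s in auto)
        then have "continuous_on UNIV (f s)" by simp
        then show ?thesis
          by (rule continuous_on_tendsto_compose) (use delay_lim[OF s] in auto)
      qed
    qed auto
    from tendsto_add[OF tendsto_const[of x0] this]
    have "(\<lambda>n. F (k n) t) \<longlonglongrightarrow> x0 + integral {0..t} (\<lambda>s. f s (g s))"
      unfolding F[OF t, symmetric] .
    with F_lim[OF t] show ?thesis by (rule LIMSEQ_unique)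
  qed
  have "(g has_vector_derivative f t (g t)) (at t within {0..T})" if t: "t \<in> {0..T}" for t
  proof (rule has_vector_derivative_transform[OF t])
    show "((\<lambda>t. x0 + integral {0..t} (\<lambda>s. f s (g s))) has_vector_derivative f t (g t))
        (at t within {0..T})"
      using has_vector_derivative_add[OF has_vector_derivative_const
          integral_has_vector_derivative[OF f_cont[OF g_cont] t], of x0]
      by simp
  qed (use eq in auto)
  moreover have "g 0 = x0" using eq[of 0] \<open>0 \<le> T\<close> by simp
  ultimately show ?thesis by (intro exI[of _ g] conjI ballI)
qed

section \<open>Convex functions and logarithmic barriers\<close>

lemma convex_gradient_inequality:
  fixes f :: "'a::real_inner \<Rightarrow> real"
  assumes "convex_on UNIV f" and D: "GDERIV f a :> D"
  shows "D \<bullet> (b - a) \<le> f b - f a"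
proof -
  define \<phi> where "\<phi> t = f (a + t *\<^sub>R (b - a))" for t
  have conv: "convex_on UNIV \<phi>"
  proof (rule convex_onI)
    fix t x y :: real assume t: "0 < t" "t < 1"
    have "a + ((1 - t) *\<^sub>R x + t *\<^sub>R y) *\<^sub>R (b - a)
        = (1 - t) *\<^sub>R (a + x *\<^sub>R (b - a)) + t *\<^sub>R (a + y *\<^sub>R (b - a))"
      by (simp add: algebra_simps)
    then show "\<phi> ((1 - t) *\<^sub>R x + t *\<^sub>R y) \<le> (1 - t) * \<phi> x + t * \<phi> y"
      using convex_onD[OF assms(1), of t] t unfolding \<phi>_def by simp
  qed simp
  have "(f has_derivative (\<lambda>v. v \<bullet> D)) (at (a + 0 *\<^sub>R (b - a)))"
    using D by (simp add: gderiv_def)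
  moreover have "((\<lambda>t. a + t *\<^sub>R (b - a)) has_derivative (\<lambda>t. t *\<^sub>R (b - a))) (at 0)"
    by (auto intro!: derivative_eq_intros)
  ultimately have "(\<phi> has_derivative (\<lambda>t. (t *\<^sub>R (b - a)) \<bullet> D)) (at 0)"
    unfolding \<phi>_def by (rule has_derivative_compose[rotated])
  then have "(\<phi> has_real_derivative ((b - a) \<bullet> D)) (at 0)"
    by (simp add: has_field_derivative_def mult.commute[of _ "(b - a) \<bullet> D"])
  from convex_on_imp_above_tangent[OF conv, of 0 1 "(b - a) \<bullet> D"] this
  have "\<phi> 1 - \<phi> 0 \<ge> ((b - a) \<bullet> D) * (1 - 0)" by auto
  then show ?thesis by (simp add: \<phi>_def inner_commute)
qed

text \<open>With \<open>x = - f a\<close> and \<open>y = - f b\<close> the two gradient inequalities bound the left-hand side by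
\<open>(x - y) / x + (y - x) / y = - (x - y)\<^sup>2 / (x y)\<close>. In other words, \<open>- ln (- f)\<close> has a monotone
gradient because it is convex.\<close>

lemma log_barrier_gradient_antimono:
  fixes f :: "'a::real_inner \<Rightarrow> real"
  assumes "convex_on UNIV f" "GDERIV f a :> Da" "GDERIV f b :> Db" and neg: "f a < 0" "f b < 0"
  shows "((1 / f a) *\<^sub>R Da - (1 / f b) *\<^sub>R Db) \<bullet> (a - b) \<le> 0"
proof -
  define x y where "x = - f a" and "y = - f b"
  have xy: "x > 0" "y > 0" using neg by (auto simp: x_def y_def)
  have "Da \<bullet> (b - a) \<le> x - y"
    using convex_gradient_inequality[OF assms(1,2), of b] by (simp add: x_def y_def)
  then have 1: "- (Da \<bullet> (a - b)) / x \<le> (x - y) / x"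
    using xy by (intro divide_right_mono) (auto simp: inner_diff_right)
  have "Db \<bullet> (a - b) \<le> y - x"
    using convex_gradient_inequality[OF assms(1,3), of a] by (simp add: x_def y_def)
  then have 2: "(Db \<bullet> (a - b)) / y \<le> (y - x) / y"
    using xy by (intro divide_right_mono) auto
  have "((1 / f a) *\<^sub>R Da - (1 / f b) *\<^sub>R Db) \<bullet> (a - b)
      = - (Da \<bullet> (a - b)) / x + (Db \<bullet> (a - b)) / y"
    by (simp add: inner_diff_left x_def y_def)
  also have "\<dots> \<le> (x - y) / x + (y - x) / y" using 1 2 by simp
  also have "\<dots> = - ((x - y)\<^sup>2 / (x * y))"
    using xy by (simp add: field_simps power2_eq_square)
  also have "\<dots> \<le> 0" using xy by simp
  finally show ?thesis .
qed

section \<open>Positive matrices and linear systems\<close>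

text \<open>A variant of Schur's product theorem, tested on the vector of ones. Expanding \<open>e\<^sub>k \<bullet> e\<^sub>j\<close> in coordinates \<open>a\<close> writes the sum as
\<open>\<Sum>\<^sub>a z\<^sub>a \<bullet> A z\<^sub>a\<close> with \<open>z\<^sub>a = \<Sum>\<^sub>k e\<^sub>k\<^sub>a g\<^sub>k\<close>.\<close>

lemma sum_quadratic_inner_nonneg:
  fixes A :: "real^'k^'k" and g :: "'j::finite \<Rightarrow> real^'k" and e :: "'j \<Rightarrow> real^'n"
  assumes pos: "\<And>z. 0 \<le> z \<bullet> (A *v z)"
  shows "0 \<le> (\<Sum>j\<in>UNIV. \<Sum>k\<in>UNIV. (g k \<bullet> (A *v g j)) * (e k \<bullet> e j))"
proof -
  have "(\<Sum>j\<in>UNIV. \<Sum>k\<in>UNIV. (g k \<bullet> (A *v g j)) * (e k \<bullet> e j))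
      = (\<Sum>j\<in>UNIV. \<Sum>k\<in>UNIV. \<Sum>a\<in>UNIV. (e k $ a *\<^sub>R g k) \<bullet> (A *v (e j $ a *\<^sub>R g j)))"
    by (simp add: inner_vec_def[of "e _"] sum_distrib_left matrix_vector_mult_scaleR mult_ac)
  also have "\<dots> = (\<Sum>j\<in>UNIV. \<Sum>a\<in>UNIV. \<Sum>k\<in>UNIV. (e k $ a *\<^sub>R g k) \<bullet> (A *v (e j $ a *\<^sub>R g j)))"
    by (intro sum.cong[OF refl] sum.swap)
  also have "\<dots> = (\<Sum>a\<in>UNIV. \<Sum>j\<in>UNIV. \<Sum>k\<in>UNIV. (e k $ a *\<^sub>R g k) \<bullet> (A *v (e j $ a *\<^sub>R g j)))"
    by (rule sum.swap)
  also have "\<dots> = (\<Sum>a\<in>UNIV. (\<Sum>k\<in>UNIV. e k $ a *\<^sub>R g k) \<bullet> (A *v (\<Sum>j\<in>UNIV. e j $ a *\<^sub>R g j)))"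
  proof (rule sum.cong[OF refl])
    fix a
    have "A *v (\<Sum>j\<in>UNIV. e j $ a *\<^sub>R g j) = (\<Sum>j\<in>UNIV. A *v (e j $ a *\<^sub>R g j))"
      by (rule linear_sum[OF matrix_vector_mul_linear])
    then show "(\<Sum>j\<in>UNIV. \<Sum>k\<in>UNIV. (e k $ a *\<^sub>R g k) \<bullet> (A *v (e j $ a *\<^sub>R g j)))
        = (\<Sum>k\<in>UNIV. e k $ a *\<^sub>R g k) \<bullet> (A *v (\<Sum>j\<in>UNIV. e j $ a *\<^sub>R g j))"
      by (simp only: inner_sum_left inner_sum_right)
  qed
  also have "\<dots> \<ge> 0" by (intro sum_nonneg pos)
  finally show ?thesis .
qed

lemma positive_matrix_det_nonzero:
  fixes A :: "real^'n^'n"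
  assumes "\<And>x. x \<noteq> 0 \<Longrightarrow> 0 < x \<bullet> (A *v x)"
  shows "det A \<noteq> 0"
proof -
  have "A *v x = 0 \<Longrightarrow> x = 0" for x using assms by (metis inner_zero_right less_irrefl)
  then have "invertible A"
    using matrix_left_invertible_ker[of A] by (simp add: invertible_left_inverse)
  then show ?thesis by (simp add: invertible_det_nz)
qed

lemma spd_matrix_inv_nonneg:
  fixes A :: "real^'n^'n"
  assumes "spd A"
  shows "0 \<le> z \<bullet> (matrix_inv A *v z)"
proof -
  have "det A \<noteq> 0"
    by (rule positive_matrix_det_nonzero) (use assms in \<open>simp add: spd_def\<close>)
  then have "invertible A" by (simp add: invertible_det_nz)
  then have "A ** matrix_inv A = mat 1"
    unfolding invertible_def matrix_inv_def by (rule someI2_ex) simp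
  then have "z = A *v (matrix_inv A *v z)"
    by (simp add: matrix_vector_mul_assoc)
  then have "z \<bullet> (matrix_inv A *v z) = (matrix_inv A *v z) \<bullet> (A *v (matrix_inv A *v z))"
    by (metis inner_commute)
  also have "\<dots> \<ge> 0"
    using assms by (cases "matrix_inv A *v z = 0") (auto simp: spd_def less_imp_le)
  finally show ?thesis .
qed

lemma outer_matrix_vector: "outer v w *v x = (w \<bullet> x) *\<^sub>R v"
  by (simp add: outer_def matrix_vector_mult_def vec_eq_iff inner_vec_def sum_distrib_left mult_ac)

lemma linear_matrix_vector_left: "linear (\<lambda>A :: real^'k^'n. A *v x)"
  by (rule linearI) (simp_all add: matrix_vector_mult_add_rdistrib scaleR_matrix_vector_assoc)

lemma continuous_on_matrix_vector:
  fixes A :: "real^'n^'m"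
  shows "continuous_on S f \<Longrightarrow> continuous_on S (\<lambda>x. A *v f x)"
  by (rule bounded_linear.continuous_on[OF matrix_vector_mul_bounded_linear])

lemma differentiable_prod_within:
  fixes f :: "'i \<Rightarrow> 'a::real_normed_vector \<Rightarrow> 'b::real_normed_field"
  assumes "\<And>i. i \<in> I \<Longrightarrow> f i differentiable (at x within S)"
  shows "(\<lambda>x. \<Prod>i\<in>I. f i x) differentiable (at x within S)"
  using assms by (induction I rule: infinite_finite_induct) auto

lemma differentiable_det:
  fixes A :: "real \<Rightarrow> real^'n^'n"
  assumes "\<And>i j. (\<lambda>s. A s $ i $ j) differentiable (at t within S)"
  shows "(\<lambda>s. det (A s)) differentiable (at t within S)"
  unfolding det_def using assms
  by (intro differentiable_sum ballI differentiable_mult differentiable_const differentiable_prod_within) auto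

lemma differentiable_vec_componentwise:
  fixes f :: "real \<Rightarrow> real^'n"
  assumes "\<And>i. (\<lambda>s. f s $ i) differentiable (at t within S)"
  shows "f differentiable (at t within S)"
proof -
  have eq: "f = (\<lambda>s. \<Sum>i\<in>UNIV. (f s $ i) *\<^sub>R axis i 1)"
    by (auto simp: vec_eq_iff axis_def if_distrib cong: if_cong)
  have "(\<lambda>s. \<Sum>i\<in>UNIV. (f s $ i) *\<^sub>R (axis i 1 :: real^'n)) differentiable (at t within S)"
    using assms by (intro differentiable_sum ballI differentiable_scaleR differentiable_const) auto
  then show ?thesis using eq by simp
qed

lemma differentiable_vec_nth:
  assumes "(f has_vector_derivative f') (at t within S)"
  shows "(\<lambda>s. f s $ i) differentiable (at t within S)"
  using bounded_linear.has_vector_derivative[OF bounded_linear_vec_nth assms]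
  by (rule differentiableI_vector)

text \<open>By Cramer's rule the solution is a quotient of determinants of differentiable matrices.\<close>

lemma differentiable_linear_system_solution:
  fixes A :: "real \<Rightarrow> real^'n^'n" and b w :: "real \<Rightarrow> real^'n"
  assumes A: "\<And>i j. (\<lambda>s. A s $ i $ j) differentiable (at t within S)"
    and b: "\<And>i. (\<lambda>s. b s $ i) differentiable (at t within S)"
    and w: "\<And>s. s \<in> S \<Longrightarrow> A s *v w s = b s"
    and det: "\<And>s. s \<in> S \<Longrightarrow> det (A s) \<noteq> 0" and "t \<in> S"
  shows "w differentiable (at t within S)"
proof -
  define c where "c s = (\<chi> k. det (\<chi> i j. if j = k then b s $ i else A s $ i $ j) / det (A s))" for s
  have "c differentiable (at t within S)"
  proof (rule differentiable_vec_componentwise)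
    fix k
    have "(\<lambda>s. det (\<chi> i j. if j = k then b s $ i else A s $ i $ j) :: real) differentiable (at t within S)"
    proof (rule differentiable_det)
      show "(\<lambda>s. (\<chi> i j. if j = k then b s $ i else A s $ i $ j) $ i $ j) differentiable (at t within S)"
        for i j by (cases "j = k") (simp_all add: A b)
    qed
    then show "(\<lambda>s. c s $ k) differentiable (at t within S)"
      unfolding c_def using differentiable_det[of A, OF A] det[OF \<open>t \<in> S\<close>]
      by (simp add: differentiable_divide)
  qed
  moreover have "w s = c s" if "s \<in> S" for s
    using cramer[OF det[OF that]] w[OF that] by (simp add: c_def)
  ultimately show ?thesis
    using \<open>t \<in> S\<close> by (metis (no_types, lifting) differentiable_def has_derivative_transform)
qed

section \<open>Bounded Lipschitz functions\<close>

text \<open>The local constant is the same at all points, so it adds up along the segment between two points.\<close>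

lemma loc_lipschitz_imp_lipschitz:
  fixes G :: "'a::real_normed_vector \<Rightarrow> 'b::metric_space"
  assumes G: "loc_lipschitz c G" and "0 \<le> c"
  shows "c-lipschitz_on UNIV G"
proof (rule lipschitz_onI)
  fix a b :: 'a
  define g where "g t = G (a + t *\<^sub>R (b - a))" for t
  have step: "\<exists>d>0. \<forall>s. \<bar>s - t\<bar> < d \<longrightarrow> dist (g s) (g t) \<le> (c * dist a b) * \<bar>s - t\<bar>" for t
  proof -
    obtain U where U: "open U" "a + t *\<^sub>R (b - a) \<in> U" "c-lipschitz_on U G"
      using G unfolding loc_lipschitz_def by blast
    obtain e where e: "e > 0" "ball (a + t *\<^sub>R (b - a)) e \<subseteq> U"
      using U open_contains_ball by blast
    have d: "dist (a + s *\<^sub>R (b - a)) (a + t *\<^sub>R (b - a)) = \<bar>s - t\<bar> * dist a b" for s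
      by (simp add: dist_norm scaleR_diff_left[symmetric] norm_minus_commute)
    show ?thesis
    proof (intro exI[of _ "e / (dist a b + 1)"] conjI allI impI)
      \<comment> \<open>The summand \<open>1\<close> covers the case \<open>a = b\<close>.\<close>
      show "0 < e / (dist a b + 1)" using e(1) by (simp add: add_nonneg_pos)
      fix s assume s: "\<bar>s - t\<bar> < e / (dist a b + 1)"
      have "\<bar>s - t\<bar> * dist a b \<le> \<bar>s - t\<bar> * (dist a b + 1)" by (intro mult_left_mono) auto
      also have "\<dots> < e" using s by (simp add: pos_less_divide_eq add_nonneg_pos)
      finally have "a + s *\<^sub>R (b - a) \<in> U" using e(2) d[of s] by (auto simp: dist_commute)
      then have "dist (g s) (g t) \<le> c * dist (a + s *\<^sub>R (b - a)) (a + t *\<^sub>R (b - a))"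
        unfolding g_def by (rule lipschitz_onD[OF U(3) _ U(2)])
      then show "dist (g s) (g t) \<le> (c * dist a b) * \<bar>s - t\<bar>"
        unfolding d by (simp only: mult_ac)
    qed
  qed
  have "(c * dist a b)-lipschitz_on {0..1} g"
  proof (rule locally_lipschitz_imp_lipschitz)
    have "isCont g t" for t unfolding continuous_at_eps_delta
    proof (intro allI impI)
      fix e :: real assume "e > 0"
      obtain d where d: "d > 0" "\<forall>s. \<bar>s - t\<bar> < d \<longrightarrow> dist (g s) (g t) \<le> (c * dist a b) * \<bar>s - t\<bar>"
        using step by blast
      define d' where "d' = min d (e / (c * dist a b + 1))"
      have pos: "0 < c * dist a b + 1" using \<open>0 \<le> c\<close> by (simp add: add_nonneg_pos)
      have "d' > 0" using d(1) \<open>e > 0\<close> pos by (simp add: d'_def)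
      moreover have "dist (g s) (g t) < e" if "dist s t < d'" for s
      proof -
        have "dist (g s) (g t) \<le> (c * dist a b) * \<bar>s - t\<bar>"
          using that d by (simp add: d'_def dist_real_def)
        also have "\<dots> \<le> (c * dist a b + 1) * \<bar>s - t\<bar>" by (intro mult_right_mono) auto
        also have "\<dots> < e"
          using that pos by (simp add: d'_def dist_real_def pos_less_divide_eq mult.commute)
        finally show ?thesis .
      qed
      ultimately show "\<exists>d>0. \<forall>x'. dist x' t < d \<longrightarrow> dist (g x') (g t) < e" by blast
    qed
    then show "continuous_on {0..1} g" by (intro continuous_at_imp_continuous_on) auto
    fix x y :: real assume "x \<in> {0..<1}" "x < y"
    obtain d where d: "d > 0" "\<forall>s. \<bar>s - x\<bar> < d \<longrightarrow> dist (g s) (g x) \<le> (c * dist a b) * \<bar>s - x\<bar>"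
      using step by blast
    show "\<exists>z\<in>{x<..y}. dist (g z) (g x) \<le> c * dist a b * (z - x)"
    proof (rule bexI)
      let ?z = "min y (x + d / 2)"
      show "?z \<in> {x<..y}" using d(1) \<open>x < y\<close> by auto
      show "dist (g ?z) (g x) \<le> c * dist a b * (?z - x)"
        using d(1) d(2)[rule_format, of ?z] \<open>x < y\<close> by (auto simp: abs_if min_def split: if_splits)
    qed
  qed (use \<open>0 \<le> c\<close> in simp)
  from lipschitz_onD[OF this, of 0 1] show "dist (G a) (G b) \<le> c * dist a b"
    by (simp add: g_def)
qed fact

text \<open>Boundedness is included so that products of such functions are again of this kind; all coefficients
of the flow are built from the particles by products, sums and the Lipschitz map \<open>G\<close>.\<close>

definition bdd_lipschitz_on :: "'a::metric_space set \<Rightarrow> ('a \<Rightarrow> 'b::real_normed_vector) \<Rightarrow> bool" where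
  "bdd_lipschitz_on B f \<longleftrightarrow> (\<exists>M L. 0 \<le> M \<and> 0 \<le> L \<and> (\<forall>x\<in>B. norm (f x) \<le> M) \<and>
     (\<forall>x\<in>B. \<forall>y\<in>B. norm (f x - f y) \<le> L * dist x y))"

lemma bdd_lipschitz_onE:
  assumes "bdd_lipschitz_on B f"
  obtains M L where "0 \<le> M" "0 \<le> L" "\<And>x. x \<in> B \<Longrightarrow> norm (f x) \<le> M"
    "\<And>x y. x \<in> B \<Longrightarrow> y \<in> B \<Longrightarrow> norm (f x - f y) \<le> L * dist x y"
  using assms unfolding bdd_lipschitz_on_def by blast

lemma bdd_lipschitz_on_const: "bdd_lipschitz_on B (\<lambda>_. c)"
  unfolding bdd_lipschitz_on_def by (rule exI[of _ "norm c"], rule exI[of _ 0]) simp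

lemma bdd_lipschitz_on_add:
  assumes "bdd_lipschitz_on B f" "bdd_lipschitz_on B g"
  shows "bdd_lipschitz_on B (\<lambda>x. f x + g x)"
proof -
  obtain M L where f: "0 \<le> M" "0 \<le> L" "\<And>x. x \<in> B \<Longrightarrow> norm (f x) \<le> M"
    "\<And>x y. x \<in> B \<Longrightarrow> y \<in> B \<Longrightarrow> norm (f x - f y) \<le> L * dist x y"
    using bdd_lipschitz_onE[OF assms(1)] by blast
  obtain M' L' where g: "0 \<le> M'" "0 \<le> L'" "\<And>x. x \<in> B \<Longrightarrow> norm (g x) \<le> M'"
    "\<And>x y. x \<in> B \<Longrightarrow> y \<in> B \<Longrightarrow> norm (g x - g y) \<le> L' * dist x y"
    using bdd_lipschitz_onE[OF assms(2)] by blast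
  show ?thesis unfolding bdd_lipschitz_on_def
  proof (rule exI[of _ "M + M'"], rule exI[of _ "L + L'"], intro conjI ballI)
    show "norm (f x + g x) \<le> M + M'" if "x \<in> B" for x
      using f(3) g(3) that by (intro norm_triangle_mono) auto
    fix x y assume xy: "x \<in> B" "y \<in> B"
    have "norm ((f x + g x) - (f y + g y)) \<le> norm (f x - f y) + norm (g x - g y)"
      by (rule norm_diff_triangle_ineq)
    then show "norm ((f x + g x) - (f y + g y)) \<le> (L + L') * dist x y"
      using f(4)[OF xy] g(4)[OF xy] by (simp add: distrib_right)
  qed (use f g in auto)
qed

lemma bdd_lipschitz_on_bilinear:
  assumes p: "bounded_bilinear p" and fg: "bdd_lipschitz_on B f" "bdd_lipschitz_on B g"
  shows "bdd_lipschitz_on B (\<lambda>x. p (f x) (g x))"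
proof -
  interpret bounded_bilinear p by (rule p)
  obtain K where K: "0 < K" "\<And>a b. norm (p a b) \<le> norm a * norm b * K" using pos_bounded by blast
  obtain M L where f: "0 \<le> M" "0 \<le> L" "\<And>x. x \<in> B \<Longrightarrow> norm (f x) \<le> M"
    "\<And>x y. x \<in> B \<Longrightarrow> y \<in> B \<Longrightarrow> norm (f x - f y) \<le> L * dist x y"
    using bdd_lipschitz_onE[OF fg(1)] by blast
  obtain M' L' where g: "0 \<le> M'" "0 \<le> L'" "\<And>x. x \<in> B \<Longrightarrow> norm (g x) \<le> M'"
    "\<And>x y. x \<in> B \<Longrightarrow> y \<in> B \<Longrightarrow> norm (g x - g y) \<le> L' * dist x y"
    using bdd_lipschitz_onE[OF fg(2)] by blast
  show ?thesis unfolding bdd_lipschitz_on_def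
  proof (rule exI[of _ "M * M' * K"], rule exI[of _ "L * M' * K + M * L' * K"], intro conjI ballI)
    show "norm (p (f x) (g x)) \<le> M * M' * K" if "x \<in> B" for x
      using f g K that by (intro order_trans[OF K(2)] mult_right_mono mult_mono) auto
    fix x y assume xy: "x \<in> B" "y \<in> B"
    have "p (f x) (g x) - p (f y) (g y) = p (f x - f y) (g x) + p (f y) (g x - g y)"
      by (simp add: diff_left diff_right)
    then have "norm (p (f x) (g x) - p (f y) (g y))
        \<le> norm (p (f x - f y) (g x)) + norm (p (f y) (g x - g y))"
      by (simp add: norm_triangle_ineq)
    also have "norm (p (f x - f y) (g x)) \<le> (L * dist x y) * M' * K"
      using f g K xy by (intro order_trans[OF K(2)] mult_right_mono mult_mono) auto
    also have "norm (p (f y) (g x - g y)) \<le> M * (L' * dist x y) * K"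
      using f g K xy by (intro order_trans[OF K(2)] mult_right_mono mult_mono) auto
    finally show "norm (p (f x) (g x) - p (f y) (g y)) \<le> (L * M' * K + M * L' * K) * dist x y"
      by (simp add: algebra_simps)
  qed (use f g K in auto)
qed

lemmas bdd_lipschitz_on_inner = bdd_lipschitz_on_bilinear[OF bounded_bilinear_inner]

lemmas bdd_lipschitz_on_scaleR = bdd_lipschitz_on_bilinear[OF bounded_bilinear_scaleR]

lemma bdd_lipschitz_on_sum:
  assumes "\<And>i. i \<in> I \<Longrightarrow> bdd_lipschitz_on B (f i)"
  shows "bdd_lipschitz_on B (\<lambda>x. \<Sum>i\<in>I. f i x)"
  using assms
  by (induction I rule: infinite_finite_induct)
    (simp_all add: bdd_lipschitz_on_const bdd_lipschitz_on_add)

lemma bdd_lipschitz_on_compose: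
  assumes "bdd_lipschitz_on B f" and G: "c-lipschitz_on UNIV G"
  shows "bdd_lipschitz_on B (\<lambda>x. G (f x))"
proof -
  obtain M L where f: "0 \<le> M" "0 \<le> L" "\<And>x. x \<in> B \<Longrightarrow> norm (f x) \<le> M"
    "\<And>x y. x \<in> B \<Longrightarrow> y \<in> B \<Longrightarrow> norm (f x - f y) \<le> L * dist x y"
    using bdd_lipschitz_onE[OF assms(1)] by blast
  have c: "0 \<le> c" by (rule lipschitz_on_nonneg[OF G])
  have lip: "norm (G u - G v) \<le> c * norm (u - v)" for u v
    using lipschitz_on_normD[OF G, of u v] by simp
  show ?thesis unfolding bdd_lipschitz_on_def
  proof (rule exI[of _ "norm (G 0) + c * M"], rule exI[of _ "c * L"], intro conjI ballI)
    show "norm (G (f x)) \<le> norm (G 0) + c * M" if "x \<in> B" for x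
    proof -
      have "norm (G (f x)) \<le> norm (G 0) + norm (G (f x) - G 0)" by (rule norm_triangle_sub)
      also have "\<dots> \<le> norm (G 0) + c * M"
        using lip[of "f x" 0] mult_left_mono[OF f(3)[OF that] c] by simp
      finally show ?thesis .
    qed
    fix x y assume xy: "x \<in> B" "y \<in> B"
    show "norm (G (f x) - G (f y)) \<le> c * L * dist x y"
      using order_trans[OF lip mult_left_mono[OF f(4)[OF xy] c]] by (simp add: mult.assoc)
  qed (use f c in auto)
qed

lemma bdd_lipschitz_on_linear:
  fixes F :: "'a::real_normed_vector \<Rightarrow> 'b::real_normed_vector"
  assumes "bounded_linear F" "bdd_lipschitz_on B f"
  shows "bdd_lipschitz_on B (\<lambda>x. F (f x))"
proof -
  obtain L where "L-lipschitz_on UNIV F"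
    using bounded_linear.lipschitz_boundE[OF assms(1)] by blast
  then show ?thesis by (rule bdd_lipschitz_on_compose[OF assms(2)])
qed

lemmas bdd_lipschitz_on_matrix =
  bdd_lipschitz_on_linear[OF matrix_vector_mul_bounded_linear]

lemma bdd_lipschitz_on_diff:
  assumes "bdd_lipschitz_on B f" "bdd_lipschitz_on B g"
  shows "bdd_lipschitz_on B (\<lambda>x. f x - g x)"
  using bdd_lipschitz_on_add[OF assms(1) bdd_lipschitz_on_linear[OF bounded_linear_minus[OF bounded_linear_ident] assms(2)]]
  by simp

lemma bdd_lipschitz_on_vec_nth:
  fixes B :: "('a::real_normed_vector^'j) set"
  assumes "bounded B"
  shows "bdd_lipschitz_on B (\<lambda>u. u $ j)"
proof -
  obtain M where M: "M > 0" "\<And>u. u \<in> B \<Longrightarrow> norm u \<le> M" using assms bounded_pos by blast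
  show ?thesis unfolding bdd_lipschitz_on_def
  proof (rule exI[of _ M], rule exI[of _ 1], intro conjI ballI)
    show "norm (u $ j) \<le> M" if "u \<in> B" for u
      using M(2)[OF that] Finite_Cartesian_Product.norm_nth_le[of u j] by linarith
    show "norm (u $ j - v $ j) \<le> 1 * dist u v" for u v
      using Finite_Cartesian_Product.norm_nth_le[of "u - v" j] by (simp add: dist_norm)
  qed (use M in auto)
qed

text \<open>Adding a second argument yields estimates that are uniform in a parameter, such as the inflation
factor or the vector to which the covariance is applied.\<close>

lemma bdd_lipschitz_on_fst:
  assumes "bdd_lipschitz_on B f"
  shows "bdd_lipschitz_on (B \<times> C) (\<lambda>p. f (fst p))"
proof -
  obtain M L where f: "0 \<le> M" "0 \<le> L" "\<And>x. x \<in> B \<Longrightarrow> norm (f x) \<le> M"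
    "\<And>x y. x \<in> B \<Longrightarrow> y \<in> B \<Longrightarrow> norm (f x - f y) \<le> L * dist x y"
    using bdd_lipschitz_onE[OF assms(1)] by blast
  show ?thesis unfolding bdd_lipschitz_on_def
  proof (rule exI[of _ M], rule exI[of _ L], intro conjI ballI)
    fix p q assume "p \<in> B \<times> C" "q \<in> B \<times> C"
    then have "norm (f (fst p) - f (fst q)) \<le> L * dist (fst p) (fst q)"
      by (intro f(4)) auto
    also have "\<dots> \<le> L * dist p q" by (intro mult_left_mono dist_fst_le f)
    finally show "norm (f (fst p) - f (fst q)) \<le> L * dist p q" .
  qed (use f in auto)
qed

lemma bdd_lipschitz_on_snd:
  fixes C :: "'b::real_normed_vector set"
  assumes "bounded C"
  shows "bdd_lipschitz_on (B \<times> C) (\<lambda>p. snd p)"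
proof -
  obtain M where M: "M > 0" "\<And>x. x \<in> C \<Longrightarrow> norm x \<le> M" using assms bounded_pos by blast
  show ?thesis unfolding bdd_lipschitz_on_def
  proof (rule exI[of _ M], rule exI[of _ 1], intro conjI ballI)
    show "norm (snd p - snd q) \<le> 1 * dist p q" for p q :: "'a \<times> 'b"
      using dist_snd_le[of p q] by (simp add: dist_norm)
  qed (use M in auto)
qed

section \<open>Ensemble means and covariances\<close>

lemma norm_vec_le_sum: "norm (u :: 'a::real_normed_vector^'j) \<le> (\<Sum>j\<in>UNIV. norm (u $ j))"
  unfolding norm_vec_def by (rule L2_set_le_sum) simp

lemma norm_vec_power2: "(norm (x :: 'a::real_normed_vector^'j))\<^sup>2 = (\<Sum>j\<in>UNIV. (norm (x $ j))\<^sup>2)"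
  by (simp add: norm_vec_def L2_set_def sum_nonneg)

lemma norm_add_power2_le: "(norm (a + b))\<^sup>2 \<le> 2 * (norm a)\<^sup>2 + 2 * (norm b)\<^sup>2"
proof -
  have "(norm (a + b))\<^sup>2 \<le> (norm a + norm b)\<^sup>2" by (intro power_mono norm_triangle_ineq) auto
  also have "\<dots> \<le> 2 * (norm a)\<^sup>2 + 2 * (norm b)\<^sup>2"
    using sum_squares_bound[of "norm a" "norm b"] by (simp add: power2_sum)
  finally show ?thesis .
qed

lemma inner_le_norm_mult:
  assumes "norm a \<le> p" "norm b \<le> q"
  shows "a \<bullet> b \<le> p * q"
  using order_trans[OF norm_cauchy_schwarz mult_mono[OF assms]] norm_ge_zero[of b]
    order_trans[OF norm_ge_zero assms(1)] by simp

lemma norm_ens_mean_le: "norm (ens_mean (u :: 'a::real_normed_vector^'j)) \<le> norm u"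
proof -
  have "norm (\<Sum>j\<in>UNIV. u $ j) \<le> (\<Sum>j\<in>(UNIV::'j set). norm u)"
    by (rule sum_norm_le) (rule Finite_Cartesian_Product.norm_nth_le)
  then show ?thesis by (simp add: ens_mean_def field_simps)
qed

lemma ens_mean_diff: "ens_mean (u - v) = ens_mean u - ens_mean v"
  by (simp add: ens_mean_def sum_subtractf scaleR_diff_right)

lemma continuous_on_vec_component:
  "continuous_on S f \<Longrightarrow> continuous_on S (\<lambda>x. (f x :: 'b::real_normed_vector^'j) $ j)"
  by (rule bounded_linear.continuous_on[OF bounded_linear_vec_nth])

lemma continuous_on_ens_mean:
  fixes f :: "'a::topological_space \<Rightarrow> 'b::real_normed_vector^'j"
  assumes "\<And>j. continuous_on S (\<lambda>x. f x $ j)"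
  shows "continuous_on S (\<lambda>x. ens_mean (f x))"
  unfolding ens_mean_def using assms
  by (intro continuous_on_scaleR continuous_on_const continuous_on_sum)

lemma bdd_lipschitz_on_ens_mean:
  assumes "\<And>j. bdd_lipschitz_on B (\<lambda>x. f x $ j)"
  shows "bdd_lipschitz_on B (\<lambda>x. ens_mean (f x))"
  unfolding ens_mean_def by (intro bdd_lipschitz_on_scaleR bdd_lipschitz_on_const bdd_lipschitz_on_sum assms)

lemma sum_deviation_zero:
  fixes v :: "('a::real_vector)^'j"
  shows "(\<Sum>j\<in>UNIV. (v $ j - ens_mean v)) = 0"
  by (simp add: sum_subtractf ens_mean_def sum_constant_scaleR)

lemma ens_cross_cov_matrix_vector:
  fixes u :: "(real^'n)^'j" and v :: "(real^'k)^'j"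
  shows "ens_cross_cov u v *v x =
    (1 / real CARD('j)) *\<^sub>R (\<Sum>k\<in>UNIV. ((v $ k - ens_mean v) \<bullet> x) *\<^sub>R (u $ k - ens_mean u))"
  unfolding ens_cross_cov_def linear_cmul[OF linear_matrix_vector_left]
    linear_sum[OF linear_matrix_vector_left] outer_matrix_vector ..

section \<open>Splitting the flow into mean and deviations\<close>

locale constrained_eki =
  fixes G :: "real^'d \<Rightarrow> real^'k" and y :: "real^'k" and \<Gamma> :: "real^'k^'k" and C0 :: "real^'d^'d"
    and h :: "'m::finite \<Rightarrow> real^'d \<Rightarrow> real" and \<tau> R c_lip :: real and \<rho> :: "real \<Rightarrow> real"
  assumes G_lipschitz: "c_lip-lipschitz_on UNIV G"
    and spd_\<Gamma>: "spd \<Gamma>" and spd_C0: "spd C0"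
    and h_convex: "\<And>i. convex_on UNIV (h i)" and h_cont_diff: "\<And>i. cont_diff (h i)"
    and \<tau>_pos: "\<tau> > 0"
    and \<rho>_range: "\<And>t. t \<ge> 0 \<Longrightarrow> 0 \<le> \<rho> t \<and> \<rho> t \<le> 1"
    and \<rho>_continuous: "continuous_on {0..} \<rho>"
    and R_nonneg: "R \<ge> 0" and feasible_bounded: "feasible h \<subseteq> cball 0 R"
begin

definition dev :: "(real^'d)^'j \<Rightarrow> 'j \<Rightarrow> real^'d" where
  "dev u j = u $ j - ens_mean u"

definition Gmean :: "(real^'d)^'j \<Rightarrow> real^'k" where
  "Gmean u = ens_mean (ens_image G u)"

definition Gdev :: "(real^'d)^'j \<Rightarrow> 'j \<Rightarrow> real^'k" where
  "Gdev u j = G (u $ j) - Gmean u"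

definition barrier :: "real^'d \<Rightarrow> real^'d" where
  "barrier x = (\<Sum>i\<in>UNIV. (1 / h i x) *\<^sub>R grad (h i) x)"

text \<open>Up to sign, the coefficient of the \<open>k\<close>-th deviation in the part of the motion of the mean that is due
to data and prior; the inflation term averages to zero over the particles.\<close>

definition drift_coeff :: "(real^'d)^'j \<Rightarrow> 'j \<Rightarrow> real" where
  "drift_coeff u k = Gdev u k \<bullet> (matrix_inv \<Gamma> *v (Gmean u - y)) + dev u k \<bullet> (matrix_inv C0 *v ens_mean u)"

definition drift :: "(real^'d)^'j \<Rightarrow> real^'d" where
  "drift u = (1 / real CARD('j)) *\<^sub>R (\<Sum>k\<in>UNIV. drift_coeff u k *\<^sub>R dev u k)"

definition cov_app :: "(real^'d)^'j \<Rightarrow> real^'d \<Rightarrow> real^'d" where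
  "cov_app u x = (1 / real CARD('j)) *\<^sub>R (\<Sum>k\<in>UNIV. (dev u k \<bullet> x) *\<^sub>R dev u k)"

text \<open>The barrier gradient is a separate argument, so that it can be replaced by a bounded one when
solutions are constructed.\<close>

definition mean_field :: "real^'d \<Rightarrow> (real^'d)^'j \<Rightarrow> real^'d" where
  "mean_field b u = (1 / \<tau>) *\<^sub>R cov_app u b - drift u"

definition data_coeff :: "(real^'d)^'j \<Rightarrow> 'j \<Rightarrow> 'j \<Rightarrow> real" where
  "data_coeff u j k = Gdev u k \<bullet> (matrix_inv \<Gamma> *v Gdev u j)"

definition prior_coeff :: "(real^'d)^'j \<Rightarrow> 'j \<Rightarrow> 'j \<Rightarrow> real" where
  "prior_coeff u j k = dev u k \<bullet> (matrix_inv C0 *v dev u j)"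

definition dev_coeff :: "real \<Rightarrow> (real^'d)^'j \<Rightarrow> 'j \<Rightarrow> 'j \<Rightarrow> real" where
  "dev_coeff r u j k = (1 - r) * data_coeff u j k + prior_coeff u j k"

definition dev_field :: "real \<Rightarrow> (real^'d)^'j \<Rightarrow> 'j \<Rightarrow> real^'d" where
  "dev_field r u j = - (1 / real CARD('j)) *\<^sub>R (\<Sum>k\<in>UNIV. dev_coeff r u j k *\<^sub>R dev u k)"

text \<open>The inflated constrained flow on a compact time interval, with the right-hand side already split
into the motion of the mean and the motion of the deviation.\<close>

definition flow_on :: "real \<Rightarrow> (real \<Rightarrow> (real^'d)^'j) \<Rightarrow> bool" where
  "flow_on T u \<longleftrightarrow> (\<forall>t\<in>{0..T}. \<forall>j. ((\<lambda>s. u s $ j) has_vector_derivative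
     mean_field (barrier (ens_mean (u t))) (u t) + dev_field (\<rho> t) (u t) j) (at t within {0..T}))"

lemma sum_dev: "(\<Sum>j\<in>UNIV. dev u j) = 0"
  unfolding dev_def by (rule sum_deviation_zero)

lemma sum_Gdev: "(\<Sum>j\<in>UNIV. Gdev u j) = 0"
  using sum_deviation_zero[of "ens_image G u"] by (simp add: Gdev_def Gmean_def ens_image_def)

text \<open>Substitute \<open>G (u $ j) = Gmean u + Gdev u j\<close> and \<open>u $ j = ens_mean u + dev u j\<close>. The parts that depend on
\<open>j\<close> form the field of the deviations, and the inflation term turns the data coefficient into
\<open>1 - r\<close> times itself.\<close>

lemma eki_rhs_decomposition:
  fixes u :: "(real^'d)^'j"
  shows "eki_rhs G y \<Gamma> C0 h \<tau> r u j = mean_field (barrier (ens_mean u)) u + dev_field r u j"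
proof -
  let ?Gi = "matrix_inv \<Gamma>" and ?Ci = "matrix_inv C0"
  have cov: "ens_cov u *v x = cov_app u x" for x
    by (simp add: ens_cov_def ens_cross_cov_matrix_vector cov_app_def dev_def)
  have cross: "ens_cross_cov u (ens_image G u) *v x =
      (1 / real CARD('j)) *\<^sub>R (\<Sum>k\<in>UNIV. (Gdev u k \<bullet> x) *\<^sub>R dev u k)" for x
    by (simp add: ens_cross_cov_matrix_vector Gdev_def Gmean_def dev_def ens_image_def)
  have G_split: "G (u $ j) - y = Gdev u j + (Gmean u - y)" and u_split: "u $ j = dev u j + ens_mean u"
    by (simp_all add: Gdev_def dev_def)
  have Gd: "G (u $ j) - ens_mean (ens_image G u) = Gdev u j" by (simp add: Gdev_def Gmean_def)
  have "drift_coeff u k + dev_coeff r u j k =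
      Gdev u k \<bullet> (?Gi *v (G (u $ j) - y)) + dev u k \<bullet> (?Ci *v (u $ j))
      - r * (Gdev u k \<bullet> (?Gi *v Gdev u j))" for k
    unfolding G_split u_split[symmetric]
    by (subst u_split) (simp add: drift_coeff_def dev_coeff_def data_coeff_def prior_coeff_def
        matrix_vector_right_distrib matrix_vector_mult_diff_distrib inner_add_right inner_diff_right algebra_simps)
  then have eq: "Gdev u k \<bullet> (?Gi *v (G (u $ j) - y)) =
      drift_coeff u k + dev_coeff r u j k - dev u k \<bullet> (?Ci *v (u $ j))
      + r * (Gdev u k \<bullet> (?Gi *v Gdev u j))" for k
    by (simp add: algebra_simps)
  show ?thesis
    unfolding eki_rhs_def cov barrier_def[symmetric] mean_field_def drift_def dev_field_def Gd cross eq
    by (simp add: cov_app_def scaleR_add_left scaleR_diff_left sum.distrib sum_subtractf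
        scaleR_add_right scaleR_diff_right scaleR_sum_right mult_ac sum_negf)
qed

text \<open>Summing the coefficients over \<open>j\<close> gives zero, since the deviations of the particles and of their
images sum to zero. This is why the mean moves according to \<open>mean_field\<close> alone.\<close>

lemma sum_dev_field:
  fixes u :: "(real^'d)^'j"
  shows "(\<Sum>j\<in>UNIV. dev_field r u j) = 0"
proof -
  have "(\<Sum>j\<in>UNIV. dev_coeff r u j k) = 0" for k
  proof -
    have "(\<Sum>j\<in>UNIV. data_coeff u j k) = Gdev u k \<bullet> (matrix_inv \<Gamma> *v (\<Sum>j\<in>UNIV. Gdev u j))"
      by (simp add: data_coeff_def inner_sum_right linear_sum[OF matrix_vector_mul_linear])
    moreover have "(\<Sum>j\<in>UNIV. prior_coeff u j k) = dev u k \<bullet> (matrix_inv C0 *v (\<Sum>j\<in>UNIV. dev u j))"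
      by (simp add: prior_coeff_def inner_sum_right linear_sum[OF matrix_vector_mul_linear])
    ultimately show ?thesis
      by (simp add: dev_coeff_def sum.distrib sum_distrib_left[symmetric] sum_dev sum_Gdev)
  qed
  moreover have "(\<Sum>j\<in>UNIV. \<Sum>k\<in>UNIV. dev_coeff r u j k *\<^sub>R dev u k)
      = (\<Sum>k\<in>UNIV. (\<Sum>j\<in>UNIV. dev_coeff r u j k) *\<^sub>R dev u k)"
    unfolding scaleR_sum_left by (rule sum.swap)
  ultimately show ?thesis
    by (simp add: dev_field_def scaleR_sum_right[symmetric] sum_negf)
qed

lemma dev_diff: "dev (u - v) j = dev u j - dev v j"
  by (simp add: dev_def ens_mean_diff)

lemma norm_dev_le: "norm (dev u j) \<le> 2 * norm u"
  using norm_triangle_ineq4[of "u $ j" "ens_mean u"] Finite_Cartesian_Product.norm_nth_le[of u j]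
    norm_ens_mean_le[of u] by (simp add: dev_def)

lemma cov_app_diff: "cov_app u (a - b) = cov_app u a - cov_app u b"
  by (simp add: cov_app_def inner_diff_right scaleR_diff_left sum_subtractf scaleR_diff_right)

lemma cov_app_inner: "z \<bullet> cov_app (u :: (real^'d)^'j) x
    = (1 / real CARD('j)) * (\<Sum>k\<in>UNIV. (dev u k \<bullet> x) * (dev u k \<bullet> z))"
  by (simp add: cov_app_def inner_sum_right inner_commute)

lemma cov_app_symmetric: "x \<bullet> cov_app u z = z \<bullet> cov_app u x"
  by (simp add: cov_app_inner mult.commute)

lemma norm_cov_app_le:
  fixes u :: "(real^'d)^'j"
  assumes "norm u \<le> M"
  shows "norm (cov_app u x) \<le> (2 * M)\<^sup>2 * norm x"
proof -
  have e: "norm (dev u k) \<le> 2 * M" for k using norm_dev_le[of u k] assms by linarith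
  have "norm (\<Sum>k\<in>UNIV. (dev u k \<bullet> x) *\<^sub>R dev u k) \<le> (\<Sum>k\<in>(UNIV::'j set). (2 * M)\<^sup>2 * norm x)"
  proof (rule sum_norm_le)
    fix k
    have "norm ((dev u k \<bullet> x) *\<^sub>R dev u k) \<le> (norm (dev u k) * norm x) * norm (dev u k)"
      by (simp add: Cauchy_Schwarz_ineq2 mult_right_mono)
    also have "\<dots> \<le> ((2 * M) * norm x) * (2 * M)"
      using e[of k] order_trans[OF norm_ge_zero e[of k]] by (intro mult_mono) auto
    finally show "norm ((dev u k \<bullet> x) *\<^sub>R dev u k) \<le> (2 * M)\<^sup>2 * norm x"
      by (simp add: power2_eq_square mult_ac)
  qed
  then show ?thesis by (simp add: cov_app_def field_simps)
qed

lemma mean_field_orthogonal: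
  assumes "\<And>k. dev u k \<bullet> x = 0"
  shows "mean_field b u \<bullet> x = 0"
  using assms by (simp add: mean_field_def cov_app_def drift_def inner_diff_left inner_sum_left)

lemma flow_on_subset:
  assumes "flow_on T u" "S \<le> T"
  shows "flow_on S u"
  unfolding flow_on_def
proof (intro ballI allI)
  fix t j assume "t \<in> {0..S}"
  then have "t \<in> {0..T}" using assms(2) by simp
  then show "((\<lambda>s. u s $ j) has_vector_derivative
     mean_field (barrier (ens_mean (u t))) (u t) + dev_field (\<rho> t) (u t) j) (at t within {0..S})"
    using assms(1) unfolding flow_on_def
    by (intro has_vector_derivative_within_subset[where S = "{0..T}" and T = "{0..S}"]) (use assms(2) in auto)
qed

lemma flow_on_zero: "flow_on 0 u"
proof -
  have "at (0::real) within {0..0} = bot" by (simp add: at_within_eq_bot_iff)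
  then show ?thesis
    unfolding flow_on_def has_vector_derivative_def has_derivative_def
    by (simp add: bounded_linear_scaleR_left)
qed

lemma flow_on_cong:
  assumes "\<And>t. t \<in> {0..T} \<Longrightarrow> u t = v t" "flow_on T u"
  shows "flow_on T v"
  unfolding flow_on_def
proof (intro ballI allI)
  fix t j assume t: "t \<in> {0..T}"
  have "((\<lambda>s. u s $ j) has_vector_derivative
      mean_field (barrier (ens_mean (u t))) (u t) + dev_field (\<rho> t) (u t) j) (at t within {0..T})"
    using assms(2) t unfolding flow_on_def by blast
  then show "((\<lambda>s. v s $ j) has_vector_derivative
      mean_field (barrier (ens_mean (v t))) (v t) + dev_field (\<rho> t) (v t) j) (at t within {0..T})"
    unfolding assms(1)[OF t, symmetric]
    by (rule has_vector_derivative_transform[OF t, rotated]) (simp add: assms(1))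
qed

lemma flow_on_mean_derivative:
  fixes u :: "real \<Rightarrow> (real^'d)^'j"
  assumes "flow_on T u" "t \<in> {0..T}"
  shows "((\<lambda>s. ens_mean (u s)) has_vector_derivative mean_field (barrier (ens_mean (u t))) (u t))
    (at t within {0..T})"
proof -
  let ?F = "mean_field (barrier (ens_mean (u t))) (u t)"
  have "((\<lambda>s. (1 / real CARD('j)) *\<^sub>R (\<Sum>j\<in>UNIV. u s $ j)) has_vector_derivative
      (1 / real CARD('j)) *\<^sub>R (\<Sum>j\<in>UNIV. ?F + dev_field (\<rho> t) (u t) j)) (at t within {0..T})"
    using assms unfolding flow_on_def
    by (intro has_vector_derivative_scaleR[where f = "\<lambda>_. 1 / real CARD('j)" and f' = 0, simplified]
        has_vector_derivative_sum) auto
  moreover have "(1 / real CARD('j)) *\<^sub>R (\<Sum>j\<in>UNIV. ?F + dev_field (\<rho> t) (u t) j) = ?F"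
    by (simp add: sum.distrib sum_dev_field sum_constant_scaleR del: sum_constant)
  ultimately show ?thesis unfolding ens_mean_def by simp
qed

lemma flow_on_dev_derivative:
  fixes u :: "real \<Rightarrow> (real^'d)^'j"
  assumes "flow_on T u" "t \<in> {0..T}"
  shows "((\<lambda>s. dev (u s) j) has_vector_derivative dev_field (\<rho> t) (u t) j) (at t within {0..T})"
proof -
  have "((\<lambda>s. u s $ j) has_vector_derivative
      mean_field (barrier (ens_mean (u t))) (u t) + dev_field (\<rho> t) (u t) j) (at t within {0..T})"
    using assms unfolding flow_on_def by blast
  from has_vector_derivative_diff[OF this flow_on_mean_derivative[OF assms]]
  show ?thesis unfolding dev_def by simp
qed

lemma flow_on_continuous:
  assumes "flow_on T u"
  shows "continuous_on {0..T} u"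
proof -
  have "continuous_on {0..T} (\<lambda>s. u s $ j)" for j
    unfolding continuous_on_eq_continuous_within
  proof
    fix t assume "t \<in> {0..T}"
    then show "continuous (at t within {0..T}) (\<lambda>s. u s $ j)"
      using assms unfolding flow_on_def by (intro has_vector_derivative_continuous) auto
  qed
  then have "continuous_on {0..T} (\<lambda>s. \<chi> j. u s $ j)" by (intro continuous_on_vec_lambda)
  then show ?thesis by simp
qed

lemma flow_on_ens_mean_continuous:
  assumes "flow_on T u"
  shows "continuous_on {0..T} (\<lambda>s. ens_mean (u s))"
  unfolding continuous_on_eq_continuous_within
  by (intro ballI has_vector_derivative_continuous[OF flow_on_mean_derivative[OF assms]])

lemma flow_on_bounded:
  fixes u :: "real \<Rightarrow> (real^'d)^'j"
  assumes "flow_on T u"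
  obtains M where "M \<ge> 0" "\<And>t. t \<in> {0..T} \<Longrightarrow> norm (u t) \<le> M"
proof -
  have "bounded (u ` {0..T})"
    by (intro compact_imp_bounded compact_continuous_image flow_on_continuous assms compact_Icc)
  then obtain M where "M > 0" "\<forall>x\<in>u ` {0..T}. norm x \<le> M" using bounded_pos by blast
  then show thesis using that[of M] by auto
qed

text \<open>A derivative within \<open>[0, t + 1]\<close> at \<open>t\<close> is the same as one within \<open>[0, \<infinity>)\<close>.\<close>

lemma eki_solution_iff_flow_on:
  "eki_solution G y \<Gamma> C0 h \<tau> \<rho> u0 u \<longleftrightarrow> u 0 = u0 \<and> (\<forall>T. flow_on T u)"
proof -
  have at_eq: "at t within {0..t + 1} = at t within {0..}" if "t \<ge> 0" for t :: real
    by (rule at_within_nhd[of t "{..<t + 1}"]) (use that in auto)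
  let ?D = "\<lambda>t S. \<forall>j. ((\<lambda>s. u s $ j) has_vector_derivative
     mean_field (barrier (ens_mean (u t))) (u t) + dev_field (\<rho> t) (u t) j) (at t within S)"
  have "(\<forall>t\<ge>0. ?D t {0..}) \<longleftrightarrow> (\<forall>T. \<forall>t\<in>{0..T}. ?D t {0..T})"
  proof (intro iffI allI ballI impI)
    fix T t :: real and j assume "\<forall>t\<ge>0. ?D t {0..}" "t \<in> {0..T}"
    then show "((\<lambda>s. u s $ j) has_vector_derivative
       mean_field (barrier (ens_mean (u t))) (u t) + dev_field (\<rho> t) (u t) j) (at t within {0..T})"
      by (intro has_vector_derivative_within_subset[where S = "{0..}" and T = "{0..T}"]) auto
  next
    fix t :: real and j assume all: "\<forall>T. \<forall>t\<in>{0..T}. ?D t {0..T}" and t: "0 \<le> t"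
    from all[rule_format, of t "t + 1" j] t
    show "((\<lambda>s. u s $ j) has_vector_derivative
       mean_field (barrier (ens_mean (u t))) (u t) + dev_field (\<rho> t) (u t) j) (at t within {0..})"
      by (simp add: at_eq)
  qed
  then show ?thesis unfolding eki_solution_def eki_rhs_decomposition flow_on_def by simp
qed

end

section \<open>Regularity of the coefficients\<close>

context constrained_eki
begin

lemma h_derivative: "(h i has_derivative (\<lambda>v. v \<bullet> grad (h i) x)) (at x)"
  using h_cont_diff[of i] unfolding cont_diff_def gderiv_def by blast

lemma h_continuous: "continuous_on S (h i)"
  by (intro continuous_at_imp_continuous_on ballI has_derivative_continuous[OF h_derivative])

lemma barrier_continuous:
  assumes "\<And>x i. x \<in> S \<Longrightarrow> h i x \<noteq> 0"
  shows "continuous_on S barrier"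
proof -
  have "continuous_on S (grad (h i))" for i
    using h_cont_diff[of i] unfolding cont_diff_def by (blast intro: continuous_on_subset)
  then show ?thesis
    unfolding barrier_def using assms by (intro continuous_intros h_continuous) auto
qed

lemma barrier_antimono:
  assumes "\<And>i. h i a < 0" "\<And>i. h i b < 0"
  shows "(barrier a - barrier b) \<bullet> (a - b) \<le> 0"
proof -
  have gd: "GDERIV (h i) x :> grad (h i) x" for i x using h_cont_diff[of i] by (simp add: cont_diff_def)
  have "(barrier a - barrier b) \<bullet> (a - b)
      = (\<Sum>i\<in>UNIV. ((1 / h i a) *\<^sub>R grad (h i) a - (1 / h i b) *\<^sub>R grad (h i) b) \<bullet> (a - b))"
    by (simp only: barrier_def sum_subtractf[symmetric] inner_sum_left)
  also have "\<dots> \<le> 0"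
    by (intro sum_nonpos log_barrier_gradient_antimono[OF h_convex gd gd] assms)
  finally show ?thesis .
qed

lemma open_strict_constraints:
  "open {w :: (real^'d)^'j. \<forall>i. h i (ens_mean w) < c}"
proof -
  have "continuous_on UNIV (\<lambda>w :: (real^'d)^'j. h i (ens_mean w))" for i
    by (rule continuous_on_compose2[OF h_continuous
        continuous_on_ens_mean[OF continuous_on_vec_component[OF continuous_on_id]]]) auto
  then have "open (\<Inter>i. {w :: (real^'d)^'j. h i (ens_mean w) < c})"
    by (intro open_INT ballI open_Collect_less continuous_on_const) auto
  moreover have "{w :: (real^'d)^'j. \<forall>i. h i (ens_mean w) < c} = (\<Inter>i. {w. h i (ens_mean w) < c})" by auto
  ultimately show ?thesis by simp
qed

lemma bdd_lipschitz_on_dev: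
  fixes B :: "((real^'d)^'j) set"
  assumes "bounded B"
  shows "bdd_lipschitz_on B (\<lambda>u. dev u j)"
  unfolding dev_def
  by (intro bdd_lipschitz_on_diff bdd_lipschitz_on_ens_mean bdd_lipschitz_on_vec_nth assms)

lemma bdd_lipschitz_on_Gmean:
  fixes B :: "((real^'d)^'j) set"
  assumes "bounded B"
  shows "bdd_lipschitz_on B (\<lambda>u. Gmean u)"
  unfolding Gmean_def ens_image_def
  by (rule bdd_lipschitz_on_ens_mean)
    (simp add: bdd_lipschitz_on_compose[OF bdd_lipschitz_on_vec_nth[OF assms] G_lipschitz])

lemma bdd_lipschitz_on_Gdev:
  fixes B :: "((real^'d)^'j) set"
  assumes "bounded B"
  shows "bdd_lipschitz_on B (\<lambda>u. Gdev u j)"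
  unfolding Gdev_def
  by (intro bdd_lipschitz_on_diff bdd_lipschitz_on_Gmean
      bdd_lipschitz_on_compose[OF _ G_lipschitz] bdd_lipschitz_on_vec_nth assms)

lemma bdd_lipschitz_on_drift_coeff:
  fixes B :: "((real^'d)^'j) set"
  assumes "bounded B"
  shows "bdd_lipschitz_on B (\<lambda>u. drift_coeff u k)"
  unfolding drift_coeff_def
  by (intro bdd_lipschitz_on_add bdd_lipschitz_on_inner bdd_lipschitz_on_matrix bdd_lipschitz_on_diff
      bdd_lipschitz_on_const bdd_lipschitz_on_dev bdd_lipschitz_on_Gdev bdd_lipschitz_on_Gmean
      bdd_lipschitz_on_ens_mean bdd_lipschitz_on_vec_nth assms)

lemma bdd_lipschitz_on_drift:
  fixes B :: "((real^'d)^'j) set"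
  assumes "bounded B"
  shows "bdd_lipschitz_on B (\<lambda>u. drift u)"
  unfolding drift_def
  by (intro bdd_lipschitz_on_scaleR bdd_lipschitz_on_sum bdd_lipschitz_on_const
      bdd_lipschitz_on_dev bdd_lipschitz_on_drift_coeff assms)

lemma bdd_lipschitz_on_cov_app:
  fixes B :: "((real^'d)^'j) set"
  assumes "bounded B" "bounded C"
  shows "bdd_lipschitz_on (B \<times> C) (\<lambda>p. cov_app (fst p) (snd p))"
  unfolding cov_app_def
  by (intro bdd_lipschitz_on_scaleR bdd_lipschitz_on_sum bdd_lipschitz_on_const bdd_lipschitz_on_inner
      bdd_lipschitz_on_fst[OF bdd_lipschitz_on_dev] bdd_lipschitz_on_snd assms)

lemma bdd_lipschitz_on_dev_coeff:
  fixes B :: "((real^'d)^'j) set"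
  assumes "bounded B"
  shows "bdd_lipschitz_on (B \<times> {0..1}) (\<lambda>p. dev_coeff (snd p) (fst p) j k)"
proof -
  have "bdd_lipschitz_on B (\<lambda>u. data_coeff u j k)" "bdd_lipschitz_on B (\<lambda>u. prior_coeff u j k)"
    unfolding data_coeff_def prior_coeff_def
    by (intro bdd_lipschitz_on_inner bdd_lipschitz_on_matrix bdd_lipschitz_on_dev bdd_lipschitz_on_Gdev assms)+
  moreover have "bdd_lipschitz_on (B \<times> {0..1}) (\<lambda>p. 1 - snd p :: real)"
    by (intro bdd_lipschitz_on_diff bdd_lipschitz_on_const bdd_lipschitz_on_snd) simp
  ultimately show ?thesis
    unfolding dev_coeff_def
    by (intro bdd_lipschitz_on_add bdd_lipschitz_on_bilinear[OF bounded_bilinear_mult]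
        bdd_lipschitz_on_fst[of B "\<lambda>u. data_coeff u j k"] bdd_lipschitz_on_fst[of B "\<lambda>u. prior_coeff u j k"])
qed

lemma bdd_lipschitz_on_dev_field:
  fixes B :: "((real^'d)^'j) set"
  assumes "bounded B"
  shows "bdd_lipschitz_on (B \<times> {0..1}) (\<lambda>p. dev_field (snd p) (fst p) j)"
  unfolding dev_field_def
  by (intro bdd_lipschitz_on_scaleR bdd_lipschitz_on_sum bdd_lipschitz_on_const
      bdd_lipschitz_on_dev_coeff bdd_lipschitz_on_fst[OF bdd_lipschitz_on_dev] assms)

lemma continuous_on_dev:
  fixes f :: "'a::topological_space \<Rightarrow> (real^'d)^'j"
  shows "continuous_on S f \<Longrightarrow> continuous_on S (\<lambda>x. dev (f x) j)"
  unfolding dev_def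
  by (intro continuous_on_diff continuous_on_ens_mean continuous_on_vec_component)

lemma continuous_on_G:
  "continuous_on S f \<Longrightarrow> continuous_on S (\<lambda>x. G (f x))"
  by (rule continuous_on_compose2[OF lipschitz_on_continuous_on[OF G_lipschitz]]) auto

lemma continuous_on_Gmean:
  fixes f :: "'a::topological_space \<Rightarrow> (real^'d)^'j"
  assumes "continuous_on S f"
  shows "continuous_on S (\<lambda>x. Gmean (f x))"
  unfolding Gmean_def
proof (rule continuous_on_ens_mean)
  show "continuous_on S (\<lambda>x. ens_image G (f x) $ j)" for j
    unfolding ens_image_def by (simp, intro continuous_on_G continuous_on_vec_component assms)
qed

lemma continuous_on_Gdev:
  fixes f :: "'a::topological_space \<Rightarrow> (real^'d)^'j"
  shows "continuous_on S f \<Longrightarrow> continuous_on S (\<lambda>x. Gdev (f x) j)"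
  unfolding Gdev_def
  by (intro continuous_on_diff continuous_on_G continuous_on_Gmean continuous_on_vec_component)

lemma continuous_on_mean_field:
  fixes f :: "'a::topological_space \<Rightarrow> (real^'d)^'j"
  shows "continuous_on S b \<Longrightarrow> continuous_on S f \<Longrightarrow> continuous_on S (\<lambda>x. mean_field (b x) (f x))"
  unfolding mean_field_def cov_app_def drift_def drift_coeff_def
  by (intro continuous_on_diff continuous_on_scaleR continuous_on_sum continuous_on_const continuous_on_add
      continuous_on_inner continuous_on_matrix_vector continuous_on_dev continuous_on_Gdev continuous_on_Gmean
      continuous_on_ens_mean continuous_on_vec_component)

lemma continuous_on_dev_field:
  fixes f :: "'a::topological_space \<Rightarrow> (real^'d)^'j"
  shows "continuous_on S r \<Longrightarrow> continuous_on S f \<Longrightarrow> continuous_on S (\<lambda>x. dev_field (r x) (f x) j)"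
  unfolding dev_field_def dev_coeff_def data_coeff_def prior_coeff_def
  by (intro continuous_on_diff continuous_on_scaleR continuous_on_sum continuous_on_const continuous_on_add
      continuous_on_mult continuous_on_inner continuous_on_matrix_vector continuous_on_dev continuous_on_Gdev)

end

section \<open>A priori bounds and invariance\<close>

context constrained_eki
begin

text \<open>The derivative is \<open>- (2/J) \<Sum>\<^sub>j\<^sub>k c\<^sub>j\<^sub>k (e\<^sub>k \<bullet> e\<^sub>j)\<close>, where \<open>c\<close> is a nonnegative combination of the two
forms treated in \<open>sum_quadratic_inner_nonneg\<close>. The bound is available before anything is known about
the mean.\<close>

lemma deviation_energy_nonincreasing:
  fixes u :: "real \<Rightarrow> (real^'d)^'j"
  assumes "flow_on T u" and t: "t \<in> {0..T}"
  shows "(\<Sum>j\<in>UNIV. (norm (dev (u t) j))\<^sup>2) \<le> (\<Sum>j\<in>UNIV. (norm (dev (u 0) j))\<^sup>2)"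
proof -
  define Z' where "Z' s = (\<Sum>j\<in>UNIV. 2 * (dev (u s) j \<bullet> dev_field (\<rho> s) (u s) j))" for s
  have "((\<lambda>s. \<Sum>j\<in>UNIV. dev (u s) j \<bullet> dev (u s) j) has_real_derivative Z' s) (at s within {0..T})"
    if "s \<in> {0..T}" for s
  proof -
    have "((\<lambda>s. dev (u s) j \<bullet> dev (u s) j) has_vector_derivative
        dev (u s) j \<bullet> dev_field (\<rho> s) (u s) j + dev_field (\<rho> s) (u s) j \<bullet> dev (u s) j)
        (at s within {0..T})" for j
      using bounded_bilinear.has_vector_derivative[OF bounded_bilinear_inner
          flow_on_dev_derivative[OF assms(1) that] flow_on_dev_derivative[OF assms(1) that]] .
    then show ?thesis
      unfolding Z'_def has_real_derivative_iff_has_vector_derivative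
      by (intro has_vector_derivative_sum) (simp add: inner_commute)
  qed
  moreover have "Z' s \<le> 0" if "0 < s" for s
  proof -
    let ?u = "u s"
    have "(\<Sum>j\<in>UNIV. dev ?u j \<bullet> dev_field (\<rho> s) ?u j) =
        - (1 / real CARD('j)) * (\<Sum>j\<in>UNIV. \<Sum>k\<in>UNIV. dev_coeff (\<rho> s) ?u j k * (dev ?u k \<bullet> dev ?u j))"
      by (simp add: dev_field_def inner_sum_right sum_distrib_left sum_negf inner_commute)
    moreover have "0 \<le> (\<Sum>j\<in>UNIV. \<Sum>k\<in>UNIV. dev_coeff (\<rho> s) ?u j k * (dev ?u k \<bullet> dev ?u j))"
    proof -
      have "0 \<le> (1 - \<rho> s) * (\<Sum>j\<in>UNIV. \<Sum>k\<in>UNIV. data_coeff ?u j k * (dev ?u k \<bullet> dev ?u j))"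
        using \<rho>_range[of s] that unfolding data_coeff_def
        by (intro mult_nonneg_nonneg sum_quadratic_inner_nonneg spd_matrix_inv_nonneg[OF spd_\<Gamma>]) auto
      moreover have "0 \<le> (\<Sum>j\<in>UNIV. \<Sum>k\<in>UNIV. prior_coeff ?u j k * (dev ?u k \<bullet> dev ?u j))"
        unfolding prior_coeff_def
        by (intro sum_quadratic_inner_nonneg spd_matrix_inv_nonneg[OF spd_C0])
      ultimately show ?thesis
        by (simp add: dev_coeff_def distrib_right sum.distrib sum_distrib_left mult.assoc)
    qed
    ultimately have "(\<Sum>j\<in>UNIV. dev ?u j \<bullet> dev_field (\<rho> s) ?u j) \<le> 0"
      by (simp add: mult_nonneg_nonneg)
    then show ?thesis by (simp add: Z'_def sum_distrib_left[symmetric])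
  qed
  ultimately have "(\<Sum>j\<in>UNIV. dev (u t) j \<bullet> dev (u t) j) \<le> (\<Sum>j\<in>UNIV. dev (u 0) j \<bullet> dev (u 0) j)"
    using t by (intro nonincreasing_of_deriv_nonpos[where a = 0 and b = T and Z' = Z' and t = t and s = 0 and
       Z = "\<lambda>s. \<Sum>j\<in>UNIV. dev (u s) j \<bullet> dev (u s) j"]) auto
  then show ?thesis by (simp add: dot_square_norm)
qed

text \<open>Each summand \<open>s\<^sup>2 / \<tau> - a s\<close> equals \<open>(s - \<tau> a / 2)\<^sup>2 / \<tau> - \<tau> a\<^sup>2 / 4\<close>.\<close>

lemma barrier_inner_mean_field_ge:
  fixes u :: "(real^'d)^'j"
  assumes a: "\<And>k. \<bar>drift_coeff u k\<bar> \<le> a"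
  shows "- (\<tau> * a\<^sup>2 / 4) \<le> b \<bullet> mean_field b u"
proof -
  let ?s = "\<lambda>k. dev u k \<bullet> b"
  have "b \<bullet> mean_field b u = (1 / real CARD('j)) * (\<Sum>k\<in>UNIV. (1 / \<tau>) * (?s k)\<^sup>2 - drift_coeff u k * ?s k)"
    by (simp add: mean_field_def cov_app_def drift_def inner_diff_right inner_sum_right
        sum_subtractf sum_distrib_left right_diff_distrib power2_eq_square inner_commute[of b] mult_ac)
  moreover have "- (\<tau> * a\<^sup>2 / 4) \<le> (1 / \<tau>) * (?s k)\<^sup>2 - drift_coeff u k * ?s k" for k
  proof -
    have "(drift_coeff u k)\<^sup>2 \<le> a\<^sup>2" using a[of k] by (rule abs_le_square_iff[THEN iffD1, OF order_trans]) simp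
    then have "\<tau> * (drift_coeff u k)\<^sup>2 \<le> \<tau> * a\<^sup>2" using \<tau>_pos by (intro mult_left_mono) auto
    moreover have "0 \<le> (1 / \<tau>) * (?s k - \<tau> * drift_coeff u k / 2)\<^sup>2" using \<tau>_pos by simp
    moreover have "(1 / \<tau>) * (?s k - \<tau> * drift_coeff u k / 2)\<^sup>2
        = (1 / \<tau>) * (?s k)\<^sup>2 - drift_coeff u k * ?s k + \<tau> * (drift_coeff u k)\<^sup>2 / 4"
      using \<tau>_pos by (simp add: power2_eq_square field_simps)
    ultimately show ?thesis by linarith
  qed
  then have "(\<Sum>k\<in>(UNIV::'j set). - (\<tau> * a\<^sup>2 / 4)) \<le> (\<Sum>k\<in>UNIV. (1 / \<tau>) * (?s k)\<^sup>2 - drift_coeff u k * ?s k)"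
    by (intro sum_mono)
  then have "(1 / real CARD('j)) * (\<Sum>k\<in>(UNIV::'j set). - (\<tau> * a\<^sup>2 / 4))
      \<le> (1 / real CARD('j)) * (\<Sum>k\<in>UNIV. (1 / \<tau>) * (?s k)\<^sup>2 - drift_coeff u k * ?s k)"
    by (intro mult_left_mono) auto
  ultimately show ?thesis by simp
qed

text \<open>The vector \<open>barrier x\<close> is the gradient of \<open>\<Sum>\<^sub>i ln (- h\<^sub>i)\<close> at \<open>x\<close>.\<close>

lemma log_barrier_derivative:
  fixes u :: "real \<Rightarrow> (real^'d)^'j"
  assumes "flow_on T u" "t \<in> {0..T}" and neg: "\<And>i. h i (ens_mean (u t)) < 0"
  shows "((\<lambda>s. \<Sum>i\<in>UNIV. ln (- h i (ens_mean (u s)))) has_real_derivative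
    barrier (ens_mean (u t)) \<bullet> mean_field (barrier (ens_mean (u t))) (u t)) (at t within {0..T})"
proof -
  let ?m = "ens_mean (u t)" let ?m' = "mean_field (barrier ?m) (u t)"
  have "((\<lambda>s. ln (- h i (ens_mean (u s)))) has_real_derivative (1 / h i ?m) * (?m' \<bullet> grad (h i) ?m))
      (at t within {0..T})" for i
  proof -
    have "((\<lambda>s. h i (ens_mean (u s))) has_derivative (\<lambda>r. (r *\<^sub>R ?m') \<bullet> grad (h i) ?m)) (at t within {0..T})"
      by (rule has_derivative_compose[OF flow_on_mean_derivative[OF assms(1,2), unfolded has_vector_derivative_def] h_derivative])
    then have "((\<lambda>s. h i (ens_mean (u s))) has_real_derivative ?m' \<bullet> grad (h i) ?m) (at t within {0..T})"
      by (simp add: has_field_derivative_def mult.commute[of _ "?m' \<bullet> _"])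
    from DERIV_chain2[OF DERIV_ln DERIV_minus[OF this]] neg[of i]
    show ?thesis by (simp add: divide_inverse)
  qed
  then have "((\<lambda>s. \<Sum>i\<in>UNIV. ln (- h i (ens_mean (u s)))) has_real_derivative
      (\<Sum>i\<in>UNIV. (1 / h i ?m) * (?m' \<bullet> grad (h i) ?m))) (at t within {0..T})"
    by (intro DERIV_sum)
  then show ?thesis by (simp add: barrier_def inner_sum_left inner_commute)
qed

lemma log_barrier_lower_bound:
  fixes u :: "real \<Rightarrow> (real^'d)^'j"
  assumes flow: "flow_on T u" and t: "0 \<le> t" "t \<le> T"
    and neg: "\<And>s i. 0 \<le> s \<Longrightarrow> s \<le> t \<Longrightarrow> h i (ens_mean (u s)) < 0"
    and a: "\<And>s k. 0 \<le> s \<Longrightarrow> s \<le> t \<Longrightarrow> \<bar>drift_coeff (u s) k\<bar> \<le> a"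
  shows "(\<Sum>i\<in>UNIV. ln (- h i (ens_mean (u 0)))) - \<tau> * a\<^sup>2 / 4 * t
    \<le> (\<Sum>i\<in>UNIV. ln (- h i (ens_mean (u t))))"
proof -
  let ?L = "\<lambda>s. \<Sum>i\<in>UNIV. ln (- h i (ens_mean (u s)))"
  let ?D = "\<lambda>s. barrier (ens_mean (u s)) \<bullet> mean_field (barrier (ens_mean (u s))) (u s)"
  have flow': "flow_on t u" using flow_on_subset[OF flow t(2)] .
  have "- ?L t - \<tau> * a\<^sup>2 / 4 * t \<le> - ?L 0 - \<tau> * a\<^sup>2 / 4 * 0"
  proof (rule nonincreasing_of_deriv_nonpos[where a = 0 and b = t and
        Z = "\<lambda>s. - ?L s - \<tau> * a\<^sup>2 / 4 * s" and Z' = "\<lambda>s. - ?D s - \<tau> * a\<^sup>2 / 4 * 1"])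
    fix s assume "s \<in> {0..t}"
    then have "(?L has_real_derivative ?D s) (at s within {0..t})"
      using neg by (intro log_barrier_derivative[OF flow']) auto
    then show "((\<lambda>s. - ?L s - \<tau> * a\<^sup>2 / 4 * s) has_real_derivative - ?D s - \<tau> * a\<^sup>2 / 4 * 1) (at s within {0..t})"
      by (intro DERIV_diff DERIV_minus DERIV_cmult DERIV_ident)
  next
    fix s assume "0 < s" "s < t"
    then show "- ?D s - \<tau> * a\<^sup>2 / 4 * 1 \<le> 0"
      using barrier_inner_mean_field_ge[of "u s" a "barrier (ens_mean (u s))"] a[of s] by simp
  qed (use t in auto)
  then show ?thesis by simp
qed

lemma feasible_interior_bounded:
  assumes "\<And>i. h i x < 0"
  shows "norm x \<le> R"
proof -
  have "x \<in> feasible h" using assms by (simp add: feasible_def less_imp_le)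
  then show ?thesis using feasible_bounded by auto
qed

text \<open>The constants depend on the initial ensemble and on \<open>T\<close> only, and the conclusion at time \<open>b\<close> uses
strict feasibility before \<open>b\<close> but not at \<open>b\<close>. It thus excludes a first exit of an arbitrary solution,
whatever the right-hand side is where some \<open>h\<^sub>i\<close> vanishes, and it confines the solutions of the capped
equation to the region where the cap is inactive.\<close>

lemma flow_a_priori_bounds:
  fixes u0 :: "(real^'d)^'j"
  assumes init: "\<And>i. h i (ens_mean u0) < 0"
  obtains M \<delta> where "0 < M" "0 < \<delta>"
    "\<And>b u. 0 \<le> b \<Longrightarrow> b \<le> T \<Longrightarrow> flow_on b u \<Longrightarrow> u 0 = u0 \<Longrightarrow>
       (\<And>t i. 0 \<le> t \<Longrightarrow> t < b \<Longrightarrow> h i (ens_mean (u t)) < 0) \<Longrightarrow>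
       norm (u b) < M \<and> (\<forall>i. h i (ens_mean (u b)) < - \<delta>)"
proof -
  define V where "V = (\<Sum>j\<in>UNIV. (norm (dev u0 j))\<^sup>2)"
  define M where "M = real CARD('j) * (R + sqrt V)"
  have "V \<ge> 0" unfolding V_def by (intro sum_nonneg) auto
  then have "M \<ge> 0" unfolding M_def using R_nonneg by simp
  have "\<exists>a. \<forall>k. \<forall>u\<in>cball (0::(real^'d)^'j) M. \<bar>drift_coeff u k\<bar> \<le> a"
  proof -
    have "\<exists>a. \<forall>u\<in>cball (0::(real^'d)^'j) M. \<bar>drift_coeff u k\<bar> \<le> a" for k
      using bdd_lipschitz_on_drift_coeff[OF bounded_cball] unfolding bdd_lipschitz_on_def real_norm_def by blast
    then obtain a where a: "\<And>k u. u \<in> cball (0::(real^'d)^'j) M \<Longrightarrow> \<bar>drift_coeff u k\<bar> \<le> a k" by metis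
    have "\<bar>drift_coeff u k\<bar> \<le> (\<Sum>k\<in>UNIV. \<bar>a k\<bar>)" if "u \<in> cball (0::(real^'d)^'j) M" for u k
      using a[OF that, of k] member_le_sum[of k UNIV "\<lambda>k. \<bar>a k\<bar>"] by auto
    then show ?thesis by blast
  qed
  then obtain a where "\<forall>k. \<forall>u\<in>cball (0::(real^'d)^'j) M. \<bar>drift_coeff u k\<bar> \<le> a" by blast
  then have a: "\<bar>drift_coeff u k\<bar> \<le> a" if "norm u \<le> M" for u :: "(real^'d)^'j" and k
    using that by simp
  have "bounded ((\<lambda>x. \<Sum>i\<in>UNIV. \<bar>h i x\<bar>) ` cball 0 R)"
    by (intro compact_imp_bounded compact_continuous_image continuous_on_sum continuous_on_rabs h_continuous) auto
  then obtain H where "H > 0" and H: "\<And>x. norm x \<le> R \<Longrightarrow> (\<Sum>i\<in>UNIV. \<bar>h i x\<bar>) \<le> H"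
    unfolding bounded_pos by auto
  define L where "L = max 0 (ln H)"
  have ln_le: "ln (- h i x) \<le> L" if "\<And>i. h i x < 0" for i x
  proof -
    have "- h i x \<le> H"
      using H[OF feasible_interior_bounded[OF that]] member_le_sum[of i UNIV "\<lambda>i. \<bar>h i x\<bar>"] that[of i]
      by auto
    then have "ln (- h i x) \<le> ln H" using that[of i] by (subst ln_le_cancel_iff) (auto simp: \<open>H > 0\<close>)
    then show ?thesis by (simp add: L_def)
  qed
  \<comment> \<open>One summand of the logarithmic barrier is bounded below by the whole sum minus the upper bounds of the others.\<close>
  define q where "q = (\<Sum>i\<in>UNIV. ln (- h i (ens_mean u0))) - \<tau> * a\<^sup>2 / 4 * T - real CARD('m) * L"
  have main: "norm (u t) \<le> M \<and> (\<forall>i. h i (ens_mean (u t)) \<le> - exp q)"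
    if flow: "flow_on T' u" and "u 0 = u0" and t: "0 \<le> t" "t \<le> T'" "t \<le> T"
      and neg: "\<And>s i. 0 \<le> s \<Longrightarrow> s \<le> t \<Longrightarrow> h i (ens_mean (u s)) < 0" for T' t and u :: "real \<Rightarrow> (real^'d)^'j"
  proof -
    have norm_le: "norm (u s) \<le> M" if s: "0 \<le> s" "s \<le> t" for s
    proof -
      have "norm (u s $ j) \<le> R + sqrt V" for j
      proof -
        have "(norm (dev (u s) j))\<^sup>2 \<le> (\<Sum>j\<in>UNIV. (norm (dev (u s) j))\<^sup>2)"
          by (rule member_le_sum) auto
        also have "\<dots> \<le> V"
          using deviation_energy_nonincreasing[OF flow, of s] s t \<open>u 0 = u0\<close> by (simp add: V_def)
        finally have "norm (dev (u s) j) \<le> sqrt V" by (rule real_le_rsqrt)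
        moreover have "norm (ens_mean (u s)) \<le> R"
          by (intro feasible_interior_bounded neg s)
        moreover have "norm (u s $ j) \<le> norm (ens_mean (u s)) + norm (dev (u s) j)"
          unfolding dev_def by (rule norm_triangle_sub)
        ultimately show ?thesis by linarith
      qed
      then have "(\<Sum>j\<in>UNIV. norm (u s $ j)) \<le> (\<Sum>j\<in>(UNIV::'j set). R + sqrt V)" by (intro sum_mono)
      then show ?thesis using norm_vec_le_sum[of "u s"] by (simp add: M_def)
    qed
    have lower: "(\<Sum>i\<in>UNIV. ln (- h i (ens_mean u0))) - \<tau> * a\<^sup>2 / 4 * T \<le> (\<Sum>i\<in>UNIV. ln (- h i (ens_mean (u t))))"
    proof -
      have "\<tau> * a\<^sup>2 / 4 * t \<le> \<tau> * a\<^sup>2 / 4 * T" using \<tau>_pos t by (intro mult_left_mono) auto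
      then show ?thesis
        using log_barrier_lower_bound[OF flow t(1,2), of a] neg a norm_le \<open>u 0 = u0\<close> by auto
    qed
    have "h i (ens_mean (u t)) \<le> - exp q" for i
    proof -
      have n: "h i (ens_mean (u t)) < 0" for i using neg t by simp
      have "L \<ge> 0" by (simp add: L_def)
      have "(\<Sum>i\<in>UNIV. ln (- h i (ens_mean (u t))))
          = ln (- h i (ens_mean (u t))) + (\<Sum>i\<in>UNIV - {i}. ln (- h i (ens_mean (u t))))"
        by (simp add: sum.remove)
      also have "(\<Sum>i\<in>UNIV - {i}. ln (- h i (ens_mean (u t)))) \<le> (\<Sum>i\<in>UNIV - {i}. L)"
        by (intro sum_mono ln_le n)
      also have "\<dots> \<le> (\<Sum>i\<in>(UNIV :: 'm set). L)"
        using \<open>L \<ge> 0\<close> by (intro sum_mono2) auto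
      finally have "q \<le> ln (- h i (ens_mean (u t)))"
        using lower by (simp add: q_def)
      then have "exp q \<le> - h i (ens_mean (u t))" using n[of i] by (simp add: ln_ge_iff)
      then show ?thesis by simp
    qed
    then show ?thesis using norm_le t by auto
  qed
  show thesis
  proof (rule that[of "M + 1" "exp q / 2"])
    fix b u assume b: "0 \<le> b" "b \<le> T" and flow: "flow_on b u" and u0: "u 0 = u0"
      and neg: "\<And>t i. 0 \<le> t \<Longrightarrow> t < b \<Longrightarrow> h i (ens_mean (u t)) < 0"
    let ?P = "\<lambda>v. norm v \<le> M \<and> (\<forall>i. h i (ens_mean v) \<le> - exp q)"
    \<comment> \<open>The estimates hold before \<open>b\<close> and pass to \<open>b\<close> by continuity; for \<open>b = 0\<close> they hold by the initial condition.\<close>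
    have "?P (u b)"
    proof (cases "b = 0")
      case True
      have "h i (ens_mean (u s)) < 0" if "0 \<le> s" "s \<le> 0" for s i using that u0 init by auto
      then show ?thesis using main[OF flow u0, of 0] True b by auto
    next
      case False
      have "?P (u t)" if "t \<in> {0..<b}" for t
        using that b by (intro main[OF flow u0] neg) auto
      moreover have "b \<in> closure {0..<b}" using False b by simp
      moreover have "continuous_on (closure {0..<b}) u"
        using flow_on_continuous[OF flow] False b by simp
      moreover have "closed {v. norm v \<le> M}" by (intro closed_Collect_le continuous_intros)
      moreover have "continuous_on {0..b} (\<lambda>t. h i (ens_mean (u t)))" for i
        by (rule continuous_on_compose2[OF h_continuous flow_on_ens_mean_continuous[OF flow]]) auto
      ultimately show ?thesis
        using False b
        by (auto intro!: continuous_le_on_closure[of "{0..<b}" "\<lambda>t. norm (u t)" b M]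
            continuous_le_on_closure[of "{0..<b}" "\<lambda>t. h _ (ens_mean (u t))" b "- exp q"] continuous_on_norm)
    qed
    then show "norm (u b) < M + 1 \<and> (\<forall>i. h i (ens_mean (u b)) < - (exp q / 2))"
      using exp_gt_zero[of q] by (smt (verit) field_sum_of_halves)
  qed (use \<open>M \<ge> 0\<close> in auto)
qed

lemma flow_stays_feasible:
  fixes u :: "real \<Rightarrow> (real^'d)^'j"
  assumes flow: "flow_on T u" and init: "\<And>i. h i (ens_mean (u 0)) < 0" and t: "t \<in> {0..T}"
  shows "h i (ens_mean (u t)) < 0"
proof -
  obtain M \<delta> where "0 < \<delta>" and bounds: "\<And>b v. 0 \<le> b \<Longrightarrow> b \<le> T \<Longrightarrow> flow_on b v \<Longrightarrow> v 0 = u 0 \<Longrightarrow>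
       (\<And>t i. 0 \<le> t \<Longrightarrow> t < b \<Longrightarrow> h i (ens_mean (v t)) < 0) \<Longrightarrow>
       norm (v b) < M \<and> (\<forall>i. h i (ens_mean (v b)) < - \<delta>)"
    using flow_a_priori_bounds[where ?u0.0 = "u 0" and T = T, OF init] by metis
  have "u t \<in> {w. \<forall>i. h i (ens_mean w) < 0}"
  proof (rule continuous_no_first_exit[OF flow_on_continuous[OF flow] open_strict_constraints])
    fix b assume b: "0 \<le> b" "b \<le> T"
      and before: "\<And>t. 0 \<le> t \<Longrightarrow> t < b \<Longrightarrow> u t \<in> {w. \<forall>i. h i (ens_mean w) < 0}"
    have "\<forall>i. h i (ens_mean (u b)) < - \<delta>"
      using bounds[OF b flow_on_subset[OF flow b(2)] refl] before by simp
    then have "\<forall>i. h i (ens_mean (u b)) < 0" using \<open>0 < \<delta>\<close> by (meson less_trans neg_less_0_iff_less)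
    then show "u b \<in> {w. \<forall>i. h i (ens_mean w) < 0}" by simp
  qed (use t in auto)
  then show ?thesis by simp
qed

end

section \<open>The span of the deviations\<close>

context constrained_eki
begin

text \<open>The products \<open>p\<^sub>j = e\<^sub>j \<bullet> x\<close> solve a linear system \<open>p' = - c p / J\<close> with bounded coefficients, so
\<open>\<Sum>\<^sub>j p\<^sub>j\<^sup>2\<close> neither reaches nor leaves zero. Hence the orthogonal complement of the span of the
deviations, and with it the span itself, is constant in time.\<close>

lemma deviations_orthogonal_iff:
  fixes u :: "real \<Rightarrow> (real^'d)^'j"
  assumes flow: "flow_on T u" and t: "t \<in> {0..T}"
  shows "(\<forall>j. dev (u t) j \<bullet> x = 0) \<longleftrightarrow> (\<forall>j. dev (u 0) j \<bullet> x = 0)"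
proof -
  obtain M where "M \<ge> 0" and M: "\<And>t. t \<in> {0..T} \<Longrightarrow> norm (u t) \<le> M"
    using flow_on_bounded[OF flow] by blast
  have "\<exists>b. \<forall>p\<in>cball (0::(real^'d)^'j) M \<times> {0..1}. \<bar>dev_coeff (snd p) (fst p) j k\<bar> \<le> b" for j k
    using bdd_lipschitz_on_dev_coeff[OF bounded_cball, of "0::(real^'d)^'j" M j k]
    unfolding bdd_lipschitz_on_def real_norm_def by blast
  then have "\<forall>q. \<exists>b. \<forall>p\<in>cball (0::(real^'d)^'j) M \<times> {0..1}. \<bar>dev_coeff (snd p) (fst p) (fst q) (snd q)\<bar> \<le> b"
    by blast
  from choice[OF this] obtain b where b:
    "\<forall>q. \<forall>p\<in>cball (0::(real^'d)^'j) M \<times> {0..1}. \<bar>dev_coeff (snd p) (fst p) (fst q) (snd q)\<bar> \<le> b q" ..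
  define \<beta> where "\<beta> = (\<Sum>q\<in>UNIV. \<bar>b q\<bar>)"
  have \<beta>: "\<bar>dev_coeff (\<rho> s) (u s) j k\<bar> \<le> \<beta>" if "s \<in> {0..T}" for s j k
  proof -
    have "\<bar>dev_coeff (\<rho> s) (u s) j k\<bar> \<le> b (j, k)"
      using b[rule_format, of "(u s, \<rho> s)" "(j, k)"] M[OF that] \<rho>_range[of s] that by simp
    also have "\<dots> \<le> \<beta>"
      unfolding \<beta>_def using member_le_sum[of "(j, k)" UNIV "\<lambda>q. \<bar>b q\<bar>"] by auto
    finally show ?thesis .
  qed
  define p where "p s j = dev (u s) j \<bullet> x" for s j
  define Z where "Z s = (\<Sum>j\<in>UNIV. (p s j)\<^sup>2)" for s
  define p' where "p' s j = dev_field (\<rho> s) (u s) j \<bullet> x" for s j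
  define Z' where "Z' s = (\<Sum>j\<in>UNIV. 2 * p s j * p' s j)" for s
  have Z_nonneg: "Z s \<ge> 0" for s unfolding Z_def by (intro sum_nonneg) auto
  have deriv: "(Z has_real_derivative Z' s) (at s within {0..T})" if "s \<in> {0..T}" for s
  proof -
    have "((\<lambda>s. p s j) has_real_derivative p' s j) (at s within {0..T})" for j
      using bounded_linear.has_vector_derivative[OF bounded_linear_inner_left[of x]
          flow_on_dev_derivative[OF flow that]]
      by (simp add: p_def p'_def has_real_derivative_iff_has_vector_derivative)
    then have "((\<lambda>s. (p s j)\<^sup>2) has_real_derivative 2 * p s j * p' s j) (at s within {0..T})" for j
      by (auto intro!: derivative_eq_intros)
    then show ?thesis unfolding Z_def Z'_def by (intro DERIV_sum)
  qed
  have growth: "\<bar>Z' s\<bar> \<le> (2 * \<beta>) * Z s" if "s \<in> {0..T}" for s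
  proof -
    have "\<beta> \<ge> 0" unfolding \<beta>_def by (intro sum_nonneg) auto
    let ?c = "\<lambda>j k. dev_coeff (\<rho> s) (u s) j k"
    have "p' s j = - (1 / real CARD('j)) * (\<Sum>k\<in>UNIV. ?c j k * p s k)" for j
      by (simp add: p'_def p_def dev_field_def inner_sum_left sum_distrib_left sum_negf)
    then have "Z' s = (\<Sum>j\<in>UNIV. \<Sum>k\<in>UNIV. - (1 / real CARD('j)) * (2 * p s j * (?c j k * p s k)))"
      unfolding Z'_def by (simp add: sum_distrib_left sum_negf mult_ac)
    also have "\<bar>\<dots>\<bar> \<le> (\<Sum>j\<in>UNIV. \<Sum>k\<in>UNIV. (1 / real CARD('j)) * (\<beta> * ((p s j)\<^sup>2 + (p s k)\<^sup>2)))"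
    proof (intro order_trans[OF sum_abs] sum_mono)
      fix j k
      have "\<bar>2 * p s j * (?c j k * p s k)\<bar> = \<bar>?c j k\<bar> * (2 * \<bar>p s j\<bar> * \<bar>p s k\<bar>)"
        by (simp add: abs_mult)
      also have "\<dots> \<le> \<beta> * ((p s j)\<^sup>2 + (p s k)\<^sup>2)"
        using \<beta>[OF that, of j k] sum_squares_bound[of "\<bar>p s j\<bar>" "\<bar>p s k\<bar>"] \<open>\<beta> \<ge> 0\<close>
        by (intro mult_mono) auto
      finally have "(1 / real CARD('j)) * \<bar>2 * p s j * (?c j k * p s k)\<bar>
          \<le> (1 / real CARD('j)) * (\<beta> * ((p s j)\<^sup>2 + (p s k)\<^sup>2))"
        by (intro mult_left_mono) auto
      moreover have "\<bar>- (1 / real CARD('j)) * z\<bar> = (1 / real CARD('j)) * \<bar>z\<bar>" for z :: real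
        unfolding abs_mult by simp
      ultimately show "\<bar>- (1 / real CARD('j)) * (2 * p s j * (?c j k * p s k))\<bar>
          \<le> (1 / real CARD('j)) * (\<beta> * ((p s j)\<^sup>2 + (p s k)\<^sup>2))"
        by (simp only:)
    qed
    also have "\<dots> = (1 / real CARD('j)) * (\<beta> * (\<Sum>j\<in>UNIV. \<Sum>k\<in>(UNIV::'j set). (p s j)\<^sup>2 + (p s k)\<^sup>2))"
      by (simp only: sum_distrib_left)
    also have "(\<Sum>j\<in>UNIV. \<Sum>k\<in>(UNIV::'j set). (p s j)\<^sup>2 + (p s k)\<^sup>2) = 2 * real CARD('j) * Z s"
      by (simp add: sum.distrib sum_distrib_left[symmetric] Z_def)
    also have "(1 / real CARD('j)) * (\<beta> * (2 * real CARD('j) * Z s)) = (2 * \<beta>) * Z s"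
      by simp
    finally show ?thesis .
  qed
  have upper: "Z' s \<le> (2 * \<beta>) * Z s" and lower: "- ((2 * \<beta>) * Z s) \<le> Z' s" if "s \<in> {0..T}" for s
    using growth[OF that] by linarith+
  have "Z t \<le> Z 0 * exp (2 * \<beta> * (t - 0))"
    by (rule gronwall_forward[where T = T and Z' = Z']) (use t deriv upper in auto)
  moreover have "Z 0 * exp (- (2 * \<beta>) * (t - 0)) \<le> Z t"
    by (rule gronwall_backward[where T = T and Z' = Z']) (use t deriv lower in auto)
  ultimately have "Z t = 0 \<longleftrightarrow> Z 0 = 0"
    using Z_nonneg[of 0] Z_nonneg[of t] by (auto simp: mult_le_0_iff)
  moreover have "Z s = 0 \<longleftrightarrow> (\<forall>j. dev (u s) j \<bullet> x = 0)" for s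
    unfolding Z_def p_def by (subst sum_nonneg_eq_0_iff) auto
  ultimately show ?thesis by simp
qed

lemma flow_mean_displacement_orthogonal:
  fixes u :: "real \<Rightarrow> (real^'d)^'j"
  assumes flow: "flow_on T u" and x: "\<And>j. dev (u 0) j \<bullet> x = 0" and t: "t \<in> {0..T}"
  shows "(ens_mean (u t) - ens_mean (u 0)) \<bullet> x = 0"
proof -
  have "((\<lambda>s. ens_mean (u s) \<bullet> x) has_vector_derivative 0) (at s within {0..T})" if "s \<in> {0..T}" for s
  proof -
    have "mean_field (barrier (ens_mean (u s))) (u s) \<bullet> x = 0"
      using deviations_orthogonal_iff[OF flow that] x by (intro mean_field_orthogonal) auto
    then show ?thesis
      using bounded_linear.has_vector_derivative[OF bounded_linear_inner_left[of x]
          flow_on_mean_derivative[OF flow that]] by simp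
  qed
  then obtain c where "\<And>s. s \<in> {0..T} \<Longrightarrow> ens_mean (u s) \<bullet> x = c"
    using has_vector_derivative_zero_constant[of "{0..T}"] by blast
  then have "ens_mean (u t) \<bullet> x = ens_mean (u 0) \<bullet> x" using t by auto
  then show ?thesis by (simp add: inner_diff_left)
qed

text \<open>The covariance, completed by the constant matrix \<open>\<Sum> n n\<^sup>T\<close>. With \<open>N\<close> a basis of the
orthogonal complement of the span of the deviations it becomes positive definite and still acts as
the covariance on that span.\<close>

definition cov_reg :: "(real^'d) set \<Rightarrow> (real^'d)^'j \<Rightarrow> real^'d^'d" where
  "cov_reg N u = (1 / real CARD('j)) *\<^sub>R (\<Sum>k\<in>UNIV. outer (dev u k) (dev u k)) + (\<Sum>n\<in>N. outer n n)"

lemma cov_reg_app: "cov_reg N u *v x = cov_app u x + (\<Sum>n\<in>N. (n \<bullet> x) *\<^sub>R n)"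
  unfolding cov_reg_def cov_app_def linear_add[OF linear_matrix_vector_left]
    linear_cmul[OF linear_matrix_vector_left] linear_sum[OF linear_matrix_vector_left] outer_matrix_vector ..

lemma cov_reg_quadratic:
  "x \<bullet> (cov_reg N (u :: (real^'d)^'j) *v x)
    = (1 / real CARD('j)) * (\<Sum>k\<in>UNIV. (dev u k \<bullet> x)\<^sup>2) + (\<Sum>n\<in>N. (n \<bullet> x)\<^sup>2)"
  by (simp add: cov_reg_app inner_add_right cov_app_inner inner_sum_right power2_eq_square inner_commute)

text \<open>A zero of the quadratic form is orthogonal to all deviations at time \<open>t\<close>, hence to those at time \<open>0\<close>, so
it lies in the span of \<open>N\<close>; being orthogonal to \<open>N\<close> as well, it vanishes. Compactness of
\<open>[0, T]\<close> times the unit sphere makes the lower bound uniform.\<close>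

lemma flow_covariance_uniformly_positive:
  fixes u :: "real \<Rightarrow> (real^'d)^'j"
  assumes flow: "flow_on T u" and "0 \<le> T"
  obtains N l where "finite N" "\<And>n j. n \<in> N \<Longrightarrow> dev (u 0) j \<bullet> n = 0" "0 < l"
    "\<And>t x. t \<in> {0..T} \<Longrightarrow> l * (norm x)\<^sup>2 \<le> x \<bullet> (cov_reg N (u t) *v x)"
proof -
  define K where "K = {x. \<forall>j. dev (u 0) j \<bullet> x = 0}"
  obtain N where N: "N \<subseteq> K" "independent N" "K \<subseteq> span N" using maximal_independent_subset by blast
  have "finite N" using N(2) independent_imp_finite by blast
  define q where "q p = (1 / real CARD('j)) * (\<Sum>k\<in>UNIV. (dev (u (fst p)) k \<bullet> snd p)\<^sup>2) + (\<Sum>n\<in>N. (n \<bullet> snd p)\<^sup>2)"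
    for p
  have q: "q (t, x) = x \<bullet> (cov_reg N (u t) *v x)" for t x
    by (simp add: q_def cov_reg_quadratic)
  have q_pos: "q (t, x) > 0" if t: "t \<in> {0..T}" and "x \<noteq> 0" for t x
  proof (rule ccontr)
    assume "\<not> 0 < q (t, x)"
    moreover have "0 \<le> (1 / real CARD('j)) * (\<Sum>k\<in>UNIV. (dev (u t) k \<bullet> x)\<^sup>2)"
      by (intro mult_nonneg_nonneg sum_nonneg) auto
    moreover have "0 \<le> (\<Sum>n\<in>N. (n \<bullet> x)\<^sup>2)" by (intro sum_nonneg) auto
    ultimately have "(1 / real CARD('j)) * (\<Sum>k\<in>UNIV. (dev (u t) k \<bullet> x)\<^sup>2) = 0"
      and z2: "(\<Sum>n\<in>N. (n \<bullet> x)\<^sup>2) = 0"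
      unfolding q_def fst_conv snd_conv by linarith+
    then have z: "(\<Sum>k\<in>UNIV. (dev (u t) k \<bullet> x)\<^sup>2) = 0" "(\<Sum>n\<in>N. (n \<bullet> x)\<^sup>2) = 0"
      by simp_all
    from z(1) have "\<forall>k. dev (u t) k \<bullet> x = 0" by (subst (asm) sum_nonneg_eq_0_iff) auto
    then have "x \<in> span N" using deviations_orthogonal_iff[OF flow t] N(3) by (auto simp: K_def)
    moreover have "orthogonal x n" if "n \<in> N" for n
      using z(2) that \<open>finite N\<close> by (subst (asm) sum_nonneg_eq_0_iff) (auto simp: orthogonal_def inner_commute)
    ultimately have "orthogonal x x" by (rule orthogonal_to_span)
    then show False using \<open>x \<noteq> 0\<close> by (simp add: orthogonal_def)
  qed
  have "continuous_on {0..T} (\<lambda>t. dev (u t) k)" for k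
    unfolding continuous_on_eq_continuous_within
    by (intro ballI has_vector_derivative_continuous[OF flow_on_dev_derivative[OF flow]])
  then have "continuous_on ({0..T} \<times> sphere 0 1) (\<lambda>p. dev (u (fst p)) k)" for k
    by (rule continuous_on_compose2) (auto intro: continuous_on_fst continuous_on_id)
  then have "continuous_on ({0..T} \<times> sphere 0 1) q"
    unfolding q_def by (intro continuous_intros) auto
  moreover have "compact ({0..T} \<times> sphere (0::real^'d) 1)" by (intro compact_Times) auto
  moreover have "{0..T} \<times> sphere (0::real^'d) 1 \<noteq> {}" using \<open>0 \<le> T\<close> by auto
  ultimately obtain p0 where p0: "p0 \<in> {0..T} \<times> sphere 0 1" "\<forall>p\<in>{0..T} \<times> sphere 0 1. q p0 \<le> q p"
    using continuous_attains_inf by blast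
  show thesis
  proof (rule that[of N "q p0"])
    show "0 < q p0" using p0(1) by (cases p0) (auto intro!: q_pos)
    show "q p0 * (norm x)\<^sup>2 \<le> x \<bullet> (cov_reg N (u t) *v x)" if "t \<in> {0..T}" for t x
    proof (cases "x = 0")
      case False
      have "q p0 \<le> q (t, (1 / norm x) *\<^sub>R x)" using p0(2) that False by simp
      also have "\<dots> = q (t, x) / (norm x)\<^sup>2"
        unfolding q by (simp add: matrix_vector_mult_scaleR power2_eq_square)
      finally show ?thesis using False q by (simp add: field_simps)
    qed simp
  qed (use \<open>finite N\<close> N K_def in auto)
qed

end

section \<open>Uniqueness\<close>

context constrained_eki
begin

text \<open>For \<open>S = cov_reg N u\<close> and \<open>w = S\<^sup>-\<^sup>1 m\<close> the energy \<open>m \<bullet> w\<close> is also \<open>2 (m \<bullet> w) - w \<bullet> S w\<close>. The second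
expression is stationary in \<open>w\<close>, so the derivative of \<open>w\<close> drops out and what remains is
\<open>2 (m' \<bullet> w) - w \<bullet> S' w\<close>. Only the differentiability of \<open>w\<close> has to be known.\<close>

lemma inverse_covariance_energy_derivative:
  fixes u v :: "real \<Rightarrow> (real^'d)^'j" and w :: "real \<Rightarrow> real^'d"
  defines "m \<equiv> \<lambda>s. ens_mean (u s) - ens_mean (v s)"
  assumes flow: "flow_on T u" "flow_on T v" and s: "s \<in> {0..T}"
    and w: "\<And>r. r \<in> {0..T} \<Longrightarrow> cov_reg N (u r) *v w r = m r"
    and det: "\<And>r. r \<in> {0..T} \<Longrightarrow> det (cov_reg N (u r)) \<noteq> 0"
  shows "((\<lambda>r. m r \<bullet> w r) has_real_derivative
      2 * ((mean_field (barrier (ens_mean (u s))) (u s) - mean_field (barrier (ens_mean (v s))) (v s)) \<bullet> w s)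
      - (2 / real CARD('j)) * (\<Sum>k\<in>UNIV. (dev (u s) k \<bullet> w s) * (dev_field (\<rho> s) (u s) k \<bullet> w s)))
    (at s within {0..T})"
proof -
  let ?F = "at s within {0..T}"
  let ?m' = "mean_field (barrier (ens_mean (u s))) (u s) - mean_field (barrier (ens_mean (v s))) (v s)"
  let ?e' = "\<lambda>k. dev_field (\<rho> s) (u s) k"
  have m': "(m has_vector_derivative ?m') ?F"
    unfolding m_def by (intro has_vector_derivative_diff flow_on_mean_derivative flow s)
  have e': "((\<lambda>r. dev (u r) k) has_vector_derivative ?e' k) ?F" for k
    by (rule flow_on_dev_derivative[OF flow(1) s])
  have "w differentiable ?F"
  proof (rule differentiable_linear_system_solution[where A = "\<lambda>r. cov_reg N (u r)" and b = m])
    show "(\<lambda>r. cov_reg N (u r) $ i $ j) differentiable ?F" for i j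
      unfolding cov_reg_def outer_def
      by (simp, intro differentiable_add differentiable_mult differentiable_divide differentiable_const
          differentiable_sum ballI differentiable_vec_nth[OF e']) auto
    show "(\<lambda>r. m r $ i) differentiable ?F" for i by (rule differentiable_vec_nth[OF m'])
  qed (use w det s in auto)
  then obtain w' where w': "(w has_vector_derivative w') ?F"
    using vector_derivative_works by blast
  let ?Q = "\<lambda>r. (1 / real CARD('j)) * (\<Sum>k\<in>UNIV. (dev (u r) k \<bullet> w r)\<^sup>2) + (\<Sum>n\<in>N. (n \<bullet> w r)\<^sup>2)"
  let ?Q' = "(1 / real CARD('j)) * (\<Sum>k\<in>UNIV. 2 * (dev (u s) k \<bullet> w s) * (dev (u s) k \<bullet> w' + ?e' k \<bullet> w s))
      + (\<Sum>n\<in>N. 2 * (n \<bullet> w s) * (n \<bullet> w'))"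
  have sq: "((\<lambda>r. (f r)\<^sup>2) has_real_derivative 2 * f s * f') ?F" if "(f has_real_derivative f') ?F" for f f'
    using that by (auto intro!: derivative_eq_intros)
  have n': "((\<lambda>r. n \<bullet> w r) has_real_derivative n \<bullet> w') ?F" for n
    using has_real_derivative_inner[OF has_vector_derivative_const w', of n] by simp
  have Q': "(?Q has_real_derivative ?Q') ?F"
    by (intro DERIV_add DERIV_cmult DERIV_sum sq n' has_real_derivative_inner[OF e' w'])
  have deriv0: "((\<lambda>r. 2 * (m r \<bullet> w r) - ?Q r) has_real_derivative 2 * (m s \<bullet> w' + ?m' \<bullet> w s) - ?Q') ?F"
    by (intro DERIV_diff DERIV_cmult has_real_derivative_inner[OF m' w'] Q')
  have same: "2 * (m r \<bullet> w r) - ?Q r = m r \<bullet> w r" if "r \<in> {0..T}" for r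
    using w[OF that] cov_reg_quadratic[of "w r" N "u r"] by (simp add: inner_commute)
  have deriv: "((\<lambda>r. m r \<bullet> w r) has_real_derivative 2 * (m s \<bullet> w' + ?m' \<bullet> w s) - ?Q') ?F"
    by (rule has_field_derivative_transform_within[OF deriv0 zero_less_one s]) (rule same)
  \<comment> \<open>By the symmetry of the completed covariance the terms with \<open>w'\<close> in \<open>?Q'\<close> are \<open>2 (m s \<bullet> w')\<close>.\<close>
  have "m s \<bullet> w' = w' \<bullet> (cov_reg N (u s) *v w s)" using w[OF s] by (simp add: inner_commute)
  also have "\<dots> = (1 / real CARD('j)) * (\<Sum>k\<in>UNIV. (dev (u s) k \<bullet> w s) * (dev (u s) k \<bullet> w'))
      + (\<Sum>n\<in>N. (n \<bullet> w s) * (n \<bullet> w'))"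
    by (simp add: cov_reg_app inner_add_right cov_app_inner inner_sum_right inner_commute)
  finally have "?Q' = 2 * (m s \<bullet> w')
      + (2 / real CARD('j)) * (\<Sum>k\<in>UNIV. (dev (u s) k \<bullet> w s) * (?e' k \<bullet> w s))"
    by (simp add: distrib_left sum.distrib sum_distrib_left mult_ac sum_divide_distrib)
  then show ?thesis using deriv by (simp add: algebra_simps)
qed

text \<open>Gronwall's inequality for \<open>m \<bullet> w + D\<close>, where \<open>m\<close> is the difference of the means, \<open>w\<close> its image under the
inverse of the completed covariance of \<open>u\<close>, and \<open>D\<close> the squared distance of the deviations. This energy
is bounded below by a multiple of the squared distance \<open>d\<^sup>2\<close> of the ensembles. In its derivative the
barrier contributes a positive multiple of \<open>(barrier a - barrier b) \<bullet> (a - b) \<le> 0\<close>, where \<open>a\<close> and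
\<open>b\<close> are the two means, and all other terms are of order \<open>d\<^sup>2\<close>.\<close>

lemma flow_unique:
  fixes u v :: "real \<Rightarrow> (real^'d)^'j"
  assumes fu: "flow_on T u" and fv: "flow_on T v" and init: "u 0 = v 0"
    and nu: "\<And>s i. s \<in> {0..T} \<Longrightarrow> h i (ens_mean (u s)) < 0"
    and nv: "\<And>s i. s \<in> {0..T} \<Longrightarrow> h i (ens_mean (v s)) < 0"
    and t: "t \<in> {0..T}"
  shows "u t = v t"
proof -
  have "0 \<le> T" using t by auto
  obtain Mu where Mu: "\<And>s. s \<in> {0..T} \<Longrightarrow> norm (u s) \<le> Mu" using flow_on_bounded[OF fu] by blast
  obtain Mv where Mv: "\<And>s. s \<in> {0..T} \<Longrightarrow> norm (v s) \<le> Mv" using flow_on_bounded[OF fv] by blast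
  define M where "M = max 0 (max Mu Mv)"
  have "M \<ge> 0" by (simp add: M_def)
  have uB: "norm (u s) \<le> M" and vB: "norm (v s) \<le> M" if "s \<in> {0..T}" for s
    using Mu[OF that] Mv[OF that] by (auto simp: M_def)
  obtain N l where "finite N" and N: "\<And>n j. n \<in> N \<Longrightarrow> dev (u 0) j \<bullet> n = 0" and "0 < l"
    and l: "\<And>s x. s \<in> {0..T} \<Longrightarrow> l * (norm x)\<^sup>2 \<le> x \<bullet> (cov_reg N (u s) *v x)"
    using flow_covariance_uniformly_positive[OF fu \<open>0 \<le> T\<close>] by blast
  define m where "m s = ens_mean (u s) - ens_mean (v s)" for s
  have det: "det (cov_reg N (u s)) \<noteq> 0" if "s \<in> {0..T}" for s
  proof (rule positive_matrix_det_nonzero)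
    fix x :: "real^'d" assume "x \<noteq> 0"
    then have "0 < l * (norm x)\<^sup>2" using \<open>0 < l\<close> by simp
    then show "0 < x \<bullet> (cov_reg N (u s) *v x)" using l[OF that] by (rule less_le_trans)
  qed
  have "\<exists>w. cov_reg N (u s) *v w = m s" if "s \<in> {0..T}" for s
    using cramer[OF det[OF that]] by blast
  then have "\<forall>s\<in>{0..T}. \<exists>w. cov_reg N (u s) *v w = m s" by blast
  from bchoice[OF this] obtain w where w: "\<And>s. s \<in> {0..T} \<Longrightarrow> cov_reg N (u s) *v w s = m s" by blast
  \<comment> \<open>The difference of the means lies in the span of the deviations, so the completing part of the
    matrix annihilates \<open>w\<close>.\<close>
  have cov_w: "cov_app (u s) (w s) = m s" if s: "s \<in> {0..T}" for s
  proof -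
    define z where "z = (\<Sum>n\<in>N. (n \<bullet> w s) *\<^sub>R n)"
    have z0: "dev (u 0) j \<bullet> z = 0" for j by (simp add: z_def inner_sum_right N)
    have "(ens_mean (u s) - ens_mean (u 0)) \<bullet> z = 0"
      by (rule flow_mean_displacement_orthogonal[OF fu z0 s])
    moreover have "(ens_mean (v s) - ens_mean (v 0)) \<bullet> z = 0"
      by (rule flow_mean_displacement_orthogonal[OF fv _ s]) (use z0 init in simp)
    ultimately have "m s \<bullet> z = 0" using init by (simp add: m_def inner_diff_left)
    moreover have "\<forall>j. dev (u s) j \<bullet> z = 0" using deviations_orthogonal_iff[OF fu s] z0 by blast
    then have "cov_app (u s) (w s) \<bullet> z = 0" by (simp add: inner_commute[of _ z] cov_app_inner)
    moreover have split: "m s = cov_app (u s) (w s) + z" using w[OF s] by (simp add: cov_reg_app z_def)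
    ultimately have "z \<bullet> z = 0" by (simp add: inner_add_left)
    then show ?thesis using split by simp
  qed
  define d where "d s = norm (u s - v s)" for s
  have m_le: "norm (m s) \<le> d s" for s
    using norm_ens_mean_le[of "u s - v s"] by (simp add: m_def d_def ens_mean_diff)
  have W_ge: "l * (norm (w s))\<^sup>2 \<le> m s \<bullet> w s" if "s \<in> {0..T}" for s
    using l[OF that, of "w s"] w[OF that] by (simp add: inner_commute)
  have w_le: "norm (w s) \<le> d s / l" if "s \<in> {0..T}" for s
  proof (cases "w s = 0")
    case False
    have "l * (norm (w s))\<^sup>2 \<le> norm (m s) * norm (w s)"
      using W_ge[OF that] norm_cauchy_schwarz order_trans by blast
    then have "l * norm (w s) \<le> norm (m s)" using False by (simp add: power2_eq_square)
    then show ?thesis using m_le[of s] \<open>0 < l\<close> by (simp add: pos_le_divide_eq mult.commute)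
  qed (simp add: d_def \<open>0 < l\<close> less_imp_le)
  have "continuous_on ((\<lambda>s. ens_mean (v s)) ` {0..T}) barrier"
    using nv by (intro barrier_continuous) (auto simp: less_imp_neq)
  then have "continuous_on {0..T} (\<lambda>s. barrier (ens_mean (v s)))"
    by (rule continuous_on_compose2[OF _ flow_on_ens_mean_continuous[OF fv]]) auto
  then have "bounded ((\<lambda>s. barrier (ens_mean (v s))) ` {0..T})"
    by (intro compact_imp_bounded compact_continuous_image) auto
  then obtain \<beta> where "\<forall>x\<in>(\<lambda>s. barrier (ens_mean (v s))) ` {0..T}. norm x \<le> \<beta>"
    unfolding bounded_iff by blast
  then have \<beta>: "norm (barrier (ens_mean (v s))) \<le> \<beta>" if "s \<in> {0..T}" for s
    using that by simp
  obtain Mc Lc where "0 \<le> Mc" "0 \<le> Lc"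
    "\<And>p. p \<in> cball (0::(real^'d)^'j) M \<times> cball 0 \<beta> \<Longrightarrow> norm (cov_app (fst p) (snd p)) \<le> Mc"
    and Lc0: "\<And>p q. p \<in> cball (0::(real^'d)^'j) M \<times> cball 0 \<beta> \<Longrightarrow>
      q \<in> cball 0 M \<times> cball 0 \<beta> \<Longrightarrow> norm (cov_app (fst p) (snd p) - cov_app (fst q) (snd q)) \<le> Lc * dist p q"
    by (rule bdd_lipschitz_onE[OF bdd_lipschitz_on_cov_app[OF bounded_cball[of "0::(real^'d)^'j" M] bounded_cball[of "0::real^'d" \<beta>]]]) (rule that)
  have Lc: "norm (cov_app (u s) (barrier (ens_mean (v s))) - cov_app (v s) (barrier (ens_mean (v s)))) \<le> Lc * d s"
    if s: "s \<in> {0..T}" for s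
    using Lc0[of "(u s, barrier (ens_mean (v s)))" "(v s, barrier (ens_mean (v s)))"] uB[OF s] vB[OF s] \<beta>[OF s]
    by (simp add: dist_Pair_Pair d_def dist_norm)
  obtain Md Ld where "0 \<le> Md" "0 \<le> Ld"
    "\<And>p. p \<in> cball (0::(real^'d)^'j) M \<Longrightarrow> norm (drift p) \<le> Md"
    and Ld0: "\<And>p q. p \<in> cball (0::(real^'d)^'j) M \<Longrightarrow>
      q \<in> cball 0 M \<Longrightarrow> norm (drift p - drift q) \<le> Ld * dist p q"
    by (rule bdd_lipschitz_onE[OF bdd_lipschitz_on_drift[OF bounded_cball[of "0::(real^'d)^'j" M]]]) (rule that)
  have Ld: "norm (drift (u s) - drift (v s)) \<le> Ld * d s" if s: "s \<in> {0..T}" for s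
    using Ld0[of "u s" "v s"] uB[OF s] vB[OF s] by (simp add: d_def dist_norm)
  have "\<exists>c. 0 \<le> fst c \<and> 0 \<le> snd c \<and> (\<forall>s\<in>{0..T}. norm (dev_field (\<rho> s) (u s) k) \<le> fst c \<and>
      norm (dev_field (\<rho> s) (u s) k - dev_field (\<rho> s) (v s) k) \<le> snd c * d s)" for k
  proof -
    obtain K L where KL: "0 \<le> K" "0 \<le> L"
      "\<And>p. p \<in> cball (0::(real^'d)^'j) M \<times> {0..1} \<Longrightarrow> norm (dev_field (snd p) (fst p) k) \<le> K"
      "\<And>p q. p \<in> cball (0::(real^'d)^'j) M \<times> {0..1} \<Longrightarrow> q \<in> cball 0 M \<times> {0..1} \<Longrightarrow>
        norm (dev_field (snd p) (fst p) k - dev_field (snd q) (fst q) k) \<le> L * dist p q"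
      by (rule bdd_lipschitz_onE[OF bdd_lipschitz_on_dev_field[OF bounded_cball[of "0::(real^'d)^'j" M], of k]]) (rule that)
    show ?thesis
    proof (intro exI[of _ "(K, L)"] conjI ballI)
      fix s assume s: "s \<in> {0..T}"
      then have r: "0 \<le> \<rho> s \<and> \<rho> s \<le> 1" using \<rho>_range by simp
      show "norm (dev_field (\<rho> s) (u s) k) \<le> fst (K, L)"
        using KL(3)[of "(u s, \<rho> s)"] uB[OF s] r by simp
      show "norm (dev_field (\<rho> s) (u s) k - dev_field (\<rho> s) (v s) k) \<le> snd (K, L) * d s"
        using KL(4)[of "(u s, \<rho> s)" "(v s, \<rho> s)"] uB[OF s] vB[OF s] r
        by (simp add: dist_Pair_Pair d_def dist_norm)
    qed (use KL in auto)
  qed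
  then have "\<forall>k. \<exists>c. 0 \<le> fst c \<and> 0 \<le> snd c \<and> (\<forall>s\<in>{0..T}. norm (dev_field (\<rho> s) (u s) k) \<le> fst c \<and>
      norm (dev_field (\<rho> s) (u s) k - dev_field (\<rho> s) (v s) k) \<le> snd c * d s)" by blast
  from choice[OF this] obtain c where c: "\<forall>k. 0 \<le> fst (c k) \<and> 0 \<le> snd (c k) \<and>
      (\<forall>s\<in>{0..T}. norm (dev_field (\<rho> s) (u s) k) \<le> fst (c k) \<and>
      norm (dev_field (\<rho> s) (u s) k - dev_field (\<rho> s) (v s) k) \<le> snd (c k) * d s)" ..
  define Mf Lf where "Mf k = fst (c k)" and "Lf k = snd (c k)" for k
  have Mf: "0 \<le> Mf k" "\<And>s. s \<in> {0..T} \<Longrightarrow> norm (dev_field (\<rho> s) (u s) k) \<le> Mf k"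
    and Lf: "0 \<le> Lf k" "\<And>s. s \<in> {0..T} \<Longrightarrow>
      norm (dev_field (\<rho> s) (u s) k - dev_field (\<rho> s) (v s) k) \<le> Lf k * d s" for k
    using c by (auto simp: Mf_def Lf_def)
  define m' where "m' s = mean_field (barrier (ens_mean (u s))) (u s) - mean_field (barrier (ens_mean (v s))) (v s)"
    for s
  define W' where "W' s = 2 * (m' s \<bullet> w s)
      - (2 / real CARD('j)) * (\<Sum>k\<in>UNIV. (dev (u s) k \<bullet> w s) * (dev_field (\<rho> s) (u s) k \<bullet> w s))" for s
  define D where "D s = (\<Sum>j\<in>UNIV. (dev (u s) j - dev (v s) j) \<bullet> (dev (u s) j - dev (v s) j))" for s
  define D' where "D' s = (\<Sum>j\<in>UNIV. 2 * ((dev (u s) j - dev (v s) j) \<bullet>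
      (dev_field (\<rho> s) (u s) j - dev_field (\<rho> s) (v s) j)))" for s
  have deriv_W: "((\<lambda>r. m r \<bullet> w r) has_real_derivative W' s) (at s within {0..T})" if "s \<in> {0..T}" for s
    unfolding W'_def m'_def m_def
    by (rule inverse_covariance_energy_derivative[OF fu fv that _ det]) (use w m_def in auto)
  have deriv_D: "(D has_real_derivative D' s) (at s within {0..T})" if "s \<in> {0..T}" for s
  proof -
    have e: "((\<lambda>r. dev (u r) j - dev (v r) j) has_vector_derivative
        dev_field (\<rho> s) (u s) j - dev_field (\<rho> s) (v s) j) (at s within {0..T})" for j
      by (intro has_vector_derivative_diff flow_on_dev_derivative fu fv that)
    have "((\<lambda>r. (dev (u r) j - dev (v r) j) \<bullet> (dev (u r) j - dev (v r) j)) has_real_derivative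
        2 * ((dev (u s) j - dev (v s) j) \<bullet> (dev_field (\<rho> s) (u s) j - dev_field (\<rho> s) (v s) j)))
        (at s within {0..T})" for j
      using has_real_derivative_inner[OF e[of j] e[of j]] by (simp add: inner_commute)
    then show ?thesis unfolding D_def D'_def by (intro DERIV_sum)
  qed
  have W'_le: "W' s \<le> (2 * (((1 / \<tau>) * Lc + Ld) / l) + 4 * M / real CARD('j) * (\<Sum>k\<in>UNIV. Mf k) / l\<^sup>2) * (d s)\<^sup>2"
    if s: "s \<in> {0..T}" for s
  proof -
    let ?bu = "barrier (ens_mean (u s))" and ?bv = "barrier (ens_mean (v s))"
    have "d s \<ge> 0" by (simp add: d_def)
    \<comment> \<open>The covariance of \<open>u\<close> is moved from the barrier difference to \<open>w\<close>, where it gives \<open>m\<close>.\<close>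
    have "m' s \<bullet> w s = (1 / \<tau>) * ((?bu - ?bv) \<bullet> m s)
        + (1 / \<tau>) * ((cov_app (u s) ?bv - cov_app (v s) ?bv) \<bullet> w s) + (- (drift (u s) - drift (v s))) \<bullet> w s"
    proof -
      have eq: "(?bu - ?bv) \<bullet> m s = (cov_app (u s) ?bu - cov_app (u s) ?bv) \<bullet> w s"
        using cov_app_symmetric[of "?bu - ?bv" "u s" "w s"] cov_w[OF s]
        by (simp add: cov_app_diff inner_commute)
      show ?thesis unfolding eq by (simp add: m'_def mean_field_def inner_diff_left algebra_simps)
    qed
    also have "\<dots> \<le> (1 / \<tau>) * 0 + (1 / \<tau>) * ((Lc * d s) * (d s / l)) + (Ld * d s) * (d s / l)"
    proof (intro add_mono mult_left_mono inner_le_norm_mult Lc w_le s)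
      show "(?bu - ?bv) \<bullet> m s \<le> 0"
        unfolding m_def using nu[OF s] nv[OF s] by (rule barrier_antimono)
      show "norm (- (drift (u s) - drift (v s))) \<le> Ld * d s" unfolding norm_minus_cancel by (rule Ld[OF s])
    qed (use \<tau>_pos in auto)
    also have "\<dots> = ((1 / \<tau>) * Lc + Ld) / l * (d s)\<^sup>2"
      using \<open>0 < l\<close> by (simp add: power2_eq_square field_simps)
    finally have 1: "2 * (m' s \<bullet> w s) \<le> 2 * (((1 / \<tau>) * Lc + Ld) / l) * (d s)\<^sup>2"
      by (simp only: mult.assoc mult_le_cancel_left_pos zero_less_numeral)
    have "- (\<Sum>k\<in>UNIV. (dev (u s) k \<bullet> w s) * (dev_field (\<rho> s) (u s) k \<bullet> w s))
        = (\<Sum>k\<in>UNIV. (- (dev (u s) k \<bullet> w s)) * (dev_field (\<rho> s) (u s) k \<bullet> w s))"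
      by (simp add: sum_negf)
    also have "\<dots> \<le> (\<Sum>k\<in>UNIV. ((2 * M) * (d s / l)) * (Mf k * (d s / l)))"
    proof (intro sum_mono)
      fix k
      have "norm (dev (u s) k) \<le> 2 * M" using norm_dev_le[of "u s" k] uB[OF s] by linarith
      then have a: "\<bar>dev (u s) k \<bullet> w s\<bar> \<le> (2 * M) * (d s / l)"
        using \<open>M \<ge> 0\<close> by (intro order_trans[OF Cauchy_Schwarz_ineq2] mult_mono w_le s) auto
      have b: "\<bar>dev_field (\<rho> s) (u s) k \<bullet> w s\<bar> \<le> Mf k * (d s / l)"
        using Mf(1)[of k] Mf(2)[OF s, of k] by (intro order_trans[OF Cauchy_Schwarz_ineq2] mult_mono w_le s) auto
      have "(- (dev (u s) k \<bullet> w s)) * (dev_field (\<rho> s) (u s) k \<bullet> w s)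
          \<le> \<bar>dev (u s) k \<bullet> w s\<bar> * \<bar>dev_field (\<rho> s) (u s) k \<bullet> w s\<bar>"
        by (metis abs_ge_self abs_minus_cancel abs_mult)
      also have "\<dots> \<le> ((2 * M) * (d s / l)) * (Mf k * (d s / l))"
        using a b \<open>M \<ge> 0\<close> \<open>d s \<ge> 0\<close> \<open>0 < l\<close> by (intro mult_mono) auto
      finally show "(- (dev (u s) k \<bullet> w s)) * (dev_field (\<rho> s) (u s) k \<bullet> w s)
          \<le> ((2 * M) * (d s / l)) * (Mf k * (d s / l))" .
    qed
    also have "\<dots> = 2 * M * (\<Sum>k\<in>UNIV. Mf k) / l\<^sup>2 * (d s)\<^sup>2"
      by (simp add: sum_distrib_left sum_divide_distrib sum_distrib_right power2_eq_square mult_ac)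
    finally have "(2 / real CARD('j)) * (- (\<Sum>k\<in>UNIV. (dev (u s) k \<bullet> w s) * (dev_field (\<rho> s) (u s) k \<bullet> w s)))
        \<le> (2 / real CARD('j)) * (2 * M * (\<Sum>k\<in>UNIV. Mf k) / l\<^sup>2 * (d s)\<^sup>2)"
      by (intro mult_left_mono) auto
    also have "\<dots> = 4 * M / real CARD('j) * (\<Sum>k\<in>UNIV. Mf k) / l\<^sup>2 * (d s)\<^sup>2"
      by simp
    finally show ?thesis using 1 unfolding W'_def distrib_right by simp
  qed
  have D'_le: "D' s \<le> 4 * (\<Sum>k\<in>UNIV. Lf k) * (d s)\<^sup>2" if s: "s \<in> {0..T}" for s
  proof -
    have "D' s \<le> (\<Sum>j\<in>UNIV. 2 * ((2 * d s) * (Lf j * d s)))"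
      unfolding D'_def
    proof (intro sum_mono mult_left_mono inner_le_norm_mult Lf s)
      show "norm (dev (u s) j - dev (v s) j) \<le> 2 * d s" for j
        using norm_dev_le[of "u s - v s" j] by (simp add: dev_diff d_def)
    qed simp
    then show ?thesis by (simp add: sum_distrib_left sum_distrib_right power2_eq_square mult_ac)
  qed
  define K1 where "K1 = 2 * (((1 / \<tau>) * Lc + Ld) / l) + 4 * M / real CARD('j) * (\<Sum>k\<in>UNIV. Mf k) / l\<^sup>2
      + 4 * (\<Sum>k\<in>UNIV. Lf k)"
  have "K1 \<ge> 0"
    unfolding K1_def using \<open>0 < l\<close> \<tau>_pos \<open>0 \<le> Lc\<close> \<open>0 \<le> Ld\<close> \<open>M \<ge> 0\<close> Mf(1) Lf(1)
    by (intro add_nonneg_nonneg divide_nonneg_nonneg mult_nonneg_nonneg sum_nonneg) auto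
  define K2 where "K2 = 2 * real CARD('j) * ((2 * M)\<^sup>2)\<^sup>2 / l + 2"
  have d_le: "(d s)\<^sup>2 \<le> K2 * (m s \<bullet> w s + D s)" if s: "s \<in> {0..T}" for s
  proof -
    have D_eq: "D s = (\<Sum>j\<in>UNIV. (norm (dev (u s) j - dev (v s) j))\<^sup>2)"
      by (simp add: D_def dot_square_norm)
    then have "D s \<ge> 0" by (simp add: sum_nonneg)
    have W_nonneg: "m s \<bullet> w s \<ge> 0"
      by (rule order_trans[OF _ W_ge[OF s]]) (use \<open>0 < l\<close> in simp)
    have "(d s)\<^sup>2 = (\<Sum>j\<in>UNIV. (norm (m s + (dev (u s) j - dev (v s) j)))\<^sup>2)"
      by (simp add: d_def norm_vec_power2 m_def dev_def)
    also have "\<dots> \<le> (\<Sum>j\<in>UNIV. 2 * (norm (m s))\<^sup>2 + 2 * (norm (dev (u s) j - dev (v s) j))\<^sup>2)"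
      by (intro sum_mono norm_add_power2_le)
    also have "\<dots> = 2 * real CARD('j) * (norm (m s))\<^sup>2 + 2 * D s"
      by (simp add: sum.distrib D_eq sum_distrib_left)
    also have "(norm (m s))\<^sup>2 \<le> ((2 * M)\<^sup>2)\<^sup>2 / l * (m s \<bullet> w s)"
    proof -
      have "(norm (m s))\<^sup>2 \<le> ((2 * M)\<^sup>2 * norm (w s))\<^sup>2"
        using norm_cov_app_le[OF uB[OF s], of "w s"] cov_w[OF s] by (intro power_mono) auto
      also have "\<dots> = ((2 * M)\<^sup>2)\<^sup>2 / l * (l * (norm (w s))\<^sup>2)"
        using \<open>0 < l\<close> by (simp add: power_mult_distrib)
      also have "\<dots> \<le> ((2 * M)\<^sup>2)\<^sup>2 / l * (m s \<bullet> w s)"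
        using W_ge[OF s] \<open>0 < l\<close> by (intro mult_left_mono) auto
      finally show ?thesis .
    qed
    finally have "(d s)\<^sup>2 \<le> 2 * real CARD('j) * (((2 * M)\<^sup>2)\<^sup>2 / l * (m s \<bullet> w s)) + 2 * D s"
      by (simp add: mult_left_mono)
    also have "\<dots> \<le> K2 * (m s \<bullet> w s) + K2 * D s"
    proof (rule add_mono)
      show "2 * D s \<le> K2 * D s"
        using \<open>D s \<ge> 0\<close> \<open>0 < l\<close> by (intro mult_right_mono) (auto simp: K2_def)
      show "2 * real CARD('j) * (((2 * M)\<^sup>2)\<^sup>2 / l * (m s \<bullet> w s)) \<le> K2 * (m s \<bullet> w s)"
        using W_nonneg by (simp add: K2_def distrib_right)
    qed
    finally show ?thesis by (simp add: distrib_left)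
  qed
  have "m t \<bullet> w t + D t \<le> (m 0 \<bullet> w 0 + D 0) * exp (K1 * K2 * (t - 0))"
  proof (rule gronwall_forward[where T = T and Z = "\<lambda>s. m s \<bullet> w s + D s" and Z' = "\<lambda>s. W' s + D' s"])
    fix s assume s: "s \<in> {0..T}"
    show "((\<lambda>s. m s \<bullet> w s + D s) has_real_derivative W' s + D' s) (at s within {0..T})"
      by (intro DERIV_add deriv_W deriv_D s)
    have "W' s + D' s \<le> K1 * (d s)\<^sup>2"
      using W'_le[OF s] D'_le[OF s] unfolding K1_def distrib_right by linarith
    also have "\<dots> \<le> K1 * (K2 * (m s \<bullet> w s + D s))" by (intro mult_left_mono d_le s \<open>K1 \<ge> 0\<close>)
    finally show "W' s + D' s \<le> K1 * K2 * (m s \<bullet> w s + D s)" by (simp only: mult.assoc)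
  qed (use t in auto)
  moreover have "m 0 = 0" "D 0 = 0" using init by (simp_all add: m_def D_def)
  ultimately have "m t \<bullet> w t + D t \<le> 0" by simp
  moreover have "K2 > 0" using \<open>0 < l\<close> by (simp add: K2_def add_nonneg_pos)
  ultimately have "(d t)\<^sup>2 \<le> 0" using d_le[OF t] by (smt (verit) mult_nonneg_nonpos)
  then show ?thesis by (simp add: d_def)
qed

end

section \<open>Existence\<close>

context constrained_eki
begin

text \<open>The denominators are kept at or below \<open>- \<delta>\<close>, which makes the field continuous everywhere.\<close>

definition capped_barrier :: "real \<Rightarrow> real^'d \<Rightarrow> real^'d" where
  "capped_barrier \<delta> x = (\<Sum>i\<in>UNIV. (1 / min (h i x) (- \<delta>)) *\<^sub>R grad (h i) x)"

lemma capped_barrier_eq: "(\<And>i. h i x \<le> - \<delta>) \<Longrightarrow> capped_barrier \<delta> x = barrier x"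
  by (simp add: capped_barrier_def barrier_def min_def)

lemma capped_barrier_continuous:
  assumes "\<delta> > 0"
  shows "continuous_on UNIV (capped_barrier \<delta>)"
proof -
  have "continuous_on UNIV (grad (h i))" for i
    using h_cont_diff[of i] unfolding cont_diff_def by blast
  moreover have "min (h i x) (- \<delta>) \<noteq> 0" for i x using assms by auto
  ultimately show ?thesis
    unfolding capped_barrier_def
    by (intro continuous_on_sum continuous_on_scaleR continuous_on_divide continuous_on_const
        continuous_on_min h_continuous) auto
qed

definition capped_field :: "real \<Rightarrow> real \<Rightarrow> (real^'d)^'j \<Rightarrow> (real^'d)^'j" where
  "capped_field \<delta> r w = (\<chi> j. mean_field (capped_barrier \<delta> (ens_mean w)) w + dev_field r w j)"

lemma continuous_on_capped_field:
  fixes f :: "'a::topological_space \<Rightarrow> (real^'d)^'j"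
  assumes "\<delta> > 0" "continuous_on S r" "continuous_on S f"
  shows "continuous_on S (\<lambda>x. capped_field \<delta> (r x) (f x))"
proof -
  have "continuous_on S (\<lambda>x. capped_barrier \<delta> (ens_mean (f x)))"
    by (rule continuous_on_compose2[OF capped_barrier_continuous[OF assms(1)]
        continuous_on_ens_mean[OF continuous_on_vec_component[OF assms(3)]]]) auto
  then show ?thesis
    unfolding capped_field_def
    by (intro continuous_on_vec_lambda continuous_on_add continuous_on_mean_field continuous_on_dev_field assms)
qed

text \<open>The field is made bounded by capping the barrier and by evaluating at the nearest point of a ball.
Peano's theorem solves the modified equation. If the solution is in the open region
\<open>norm w < M\<close>, \<open>h i (ens_mean w) < - \<delta>\<close> before time \<open>b\<close>, it solves the original equation up to \<open>b\<close>, and the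
a priori bounds place it in this region at \<open>b\<close> as well; hence it never leaves.\<close>

lemma flow_exists:
  fixes u0 :: "(real^'d)^'j"
  assumes init: "\<And>i. h i (ens_mean u0) < 0" and "0 \<le> T"
  shows "\<exists>u. u 0 = u0 \<and> flow_on T u"
proof -
  obtain M \<delta> where "0 < M" "0 < \<delta>" and bounds: "\<And>b v. 0 \<le> b \<Longrightarrow> b \<le> T \<Longrightarrow> flow_on b v \<Longrightarrow> v 0 = u0 \<Longrightarrow>
       (\<And>t i. 0 \<le> t \<Longrightarrow> t < b \<Longrightarrow> h i (ens_mean (v t)) < 0) \<Longrightarrow>
       norm (v b) < M \<and> (\<forall>i. h i (ens_mean (v b)) < - \<delta>)"
    using flow_a_priori_bounds[where ?u0.0 = u0 and T = T, OF init] by metis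
  define B where "B = cball (0::(real^'d)^'j) M"
  have B: "closed B" "convex B" "B \<noteq> {}" using \<open>0 < M\<close> by (auto simp: B_def)
  define f where "f t w = capped_field \<delta> (\<rho> t) (closest_point B w)" for t w
  have proj_cont: "continuous_on UNIV (closest_point B)"
    by (rule continuous_on_closest_point[OF B(2,1,3)])
  have f_cont: "continuous_on ({0..T} \<times> UNIV) (\<lambda>(t, w). f t w)"
  proof -
    have "continuous_on ({0..T} \<times> (UNIV::((real^'d)^'j) set)) (\<lambda>p. \<rho> (fst p))"
      by (rule continuous_on_compose2[OF \<rho>_continuous]) (auto intro: continuous_on_fst continuous_on_id)
    moreover have "continuous_on ({0..T} \<times> UNIV) (\<lambda>p. closest_point B (snd p))"
      by (rule continuous_on_compose2[OF proj_cont]) (auto intro: continuous_on_snd continuous_on_id)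
    ultimately show ?thesis
      unfolding f_def case_prod_beta by (intro continuous_on_capped_field \<open>0 < \<delta>\<close>)
  qed
  have "bounded ((\<lambda>p. capped_field \<delta> (fst p) (snd p)) ` ({0..1} \<times> B))"
    by (intro compact_imp_bounded compact_continuous_image compact_Times continuous_on_capped_field \<open>0 < \<delta>\<close>
        continuous_on_fst continuous_on_snd continuous_on_id) (auto simp: B_def)
  then obtain K where K: "\<forall>x\<in>(\<lambda>p. capped_field \<delta> (fst p) (snd p)) ` ({0..1} \<times> B). norm x \<le> K"
    unfolding bounded_iff by blast
  have f_bound: "norm (f t w) \<le> K" if "t \<in> {0..T}" for t w
  proof -
    have "(\<rho> t, closest_point B w) \<in> {0..1} \<times> B"
      using \<rho>_range[of t] that closest_point_in_set[OF B(1,3)] by auto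
    from K[rule_format, OF imageI[OF this]] show ?thesis by (simp add: f_def)
  qed
  obtain u where u0: "u 0 = u0"
    and u: "\<And>t. t \<in> {0..T} \<Longrightarrow> (u has_vector_derivative f t (u t)) (at t within {0..T})"
    using peano_existence[OF f_cont f_bound \<open>0 \<le> T\<close>, of u0] by blast
  have u_cont: "continuous_on {0..T} u"
    unfolding continuous_on_eq_continuous_within using has_vector_derivative_continuous[OF u] by blast
  have mean_cont: "continuous_on {0..T} (\<lambda>t. h i (ens_mean (u t)))" for i
    by (rule continuous_on_compose2[OF h_continuous
        continuous_on_ens_mean[OF continuous_on_vec_component[OF u_cont]]]) auto
  have flow_of_inactive: "flow_on b u" if "b \<le> T"
    and inactive: "\<And>t i. t \<in> {0..b} \<Longrightarrow> norm (u t) \<le> M \<and> h i (ens_mean (u t)) \<le> - \<delta>" for b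
    unfolding flow_on_def
  proof (intro ballI allI)
    fix t j assume t: "t \<in> {0..b}"
    have "u t \<in> B" using inactive[OF t] by (simp add: B_def)
    then have "closest_point B (u t) = u t" by (rule closest_point_self)
    then have "f t (u t) $ j = mean_field (barrier (ens_mean (u t))) (u t) + dev_field (\<rho> t) (u t) j"
      using capped_barrier_eq[of "ens_mean (u t)" \<delta>] inactive[OF t] by (simp add: f_def capped_field_def)
    moreover have "((\<lambda>s. u s $ j) has_vector_derivative f t (u t) $ j) (at t within {0..b})"
      using t \<open>b \<le> T\<close>
      by (intro bounded_linear.has_vector_derivative[OF bounded_linear_vec_nth]
          has_vector_derivative_within_subset[OF u]) auto
    ultimately show "((\<lambda>s. u s $ j) has_vector_derivative
        mean_field (barrier (ens_mean (u t))) (u t) + dev_field (\<rho> t) (u t) j) (at t within {0..b})"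
      by simp
  qed
  let ?U = "{w. norm w < M} \<inter> {w. \<forall>i. h i (ens_mean w) < - \<delta>}"
  have inside: "u t \<in> ?U" if t: "0 \<le> t" "t \<le> T" for t
  proof (rule continuous_no_first_exit[OF u_cont _ _ t])
    show "open ?U" by (intro open_Int open_strict_constraints open_Collect_less continuous_intros)
    fix b assume b: "0 \<le> b" "b \<le> T" and before: "\<And>t. 0 \<le> t \<Longrightarrow> t < b \<Longrightarrow> u t \<in> ?U"
    have fl: "flow_on b u"
    proof (cases "b = 0")
      case False
      \<comment> \<open>At \<open>b\<close> itself only the weak inequalities are known, and these suffice for the cap to be inactive.\<close>
      have cl: "closure {0..<b} = {0..b}" using False b by simp
      have "norm (u t) \<le> M" if t: "t \<in> {0..b}" for t
      proof (rule continuous_le_on_closure[of "{0..<b}" "\<lambda>t. norm (u t)"])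
        show "continuous_on (closure {0..<b}) (\<lambda>t. norm (u t))"
          unfolding cl by (intro continuous_on_norm continuous_on_subset[OF u_cont]) (use b in auto)
        show "t \<in> closure {0..<b}" unfolding cl by (rule t)
      qed (use before in \<open>auto simp: less_imp_le\<close>)
      moreover have "h i (ens_mean (u t)) \<le> - \<delta>" if t: "t \<in> {0..b}" for t i
      proof (rule continuous_le_on_closure[of "{0..<b}" "\<lambda>t. h i (ens_mean (u t))"])
        show "continuous_on (closure {0..<b}) (\<lambda>t. h i (ens_mean (u t)))"
          unfolding cl by (rule continuous_on_subset[OF mean_cont]) (use b in auto)
        show "t \<in> closure {0..<b}" unfolding cl by (rule t)
      qed (use before in \<open>auto simp: less_imp_le\<close>)
      ultimately show ?thesis by (intro flow_of_inactive[OF b(2)]) simp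
    qed (simp add: flow_on_zero)
    have neg: "h i (ens_mean (u t)) < 0" if "0 \<le> t" "t < b" for t i
    proof -
      have "h i (ens_mean (u t)) < - \<delta>" using before[OF that] by simp
      then show ?thesis using \<open>0 < \<delta>\<close> by simp
    qed
    show "u b \<in> ?U" using bounds[OF b fl u0 neg] by simp
  qed
  have "flow_on T u"
  proof (rule flow_of_inactive[OF order_refl])
    fix t i assume "t \<in> {0..T}"
    then show "norm (u t) \<le> M \<and> h i (ens_mean (u t)) \<le> - \<delta>"
      using inside[of t] by (auto intro: less_imp_le)
  qed
  then show ?thesis using u0 by blast
qed

text \<open>By uniqueness the solutions on \<open>[0, n]\<close> extend each other, so at time \<open>t\<close> any of those with \<open>n \<ge> t\<close>
may be taken.\<close>

lemma global_flow_exists: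
  fixes u0 :: "(real^'d)^'j"
  assumes init: "\<And>i. h i (ens_mean u0) < 0"
  shows "\<exists>u. u 0 = u0 \<and> (\<forall>T. flow_on T u)"
proof -
  have "\<forall>n. \<exists>u. u 0 = u0 \<and> flow_on (real n) u" using flow_exists[OF init] by simp
  from choice[OF this] obtain U where U: "\<forall>n. U n 0 = u0 \<and> flow_on (real n) (U n)" ..
  have agree: "U k t = U n t" if "t \<in> {0..real k}" "t \<in> {0..real n}" for k n t
  proof (rule flow_unique)
    let ?T = "min (real k) (real n)"
    show fk: "flow_on ?T (U k)" using U by (auto intro: flow_on_subset[of "real k"])
    show fn: "flow_on ?T (U n)" using U by (auto intro: flow_on_subset[of "real n"])
    show "U k 0 = U n 0" using U by simp
    show "h i (ens_mean (U k s)) < 0" if "s \<in> {0..?T}" for s i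
      using U init by (intro flow_stays_feasible[OF fk _ that]) simp
    show "h i (ens_mean (U n s)) < 0" if "s \<in> {0..?T}" for s i
      using U init by (intro flow_stays_feasible[OF fn _ that]) simp
    show "t \<in> {0..?T}" using that by simp
  qed
  define u where "u t = U (nat \<lceil>t\<rceil>) t" for t
  have u: "u t = U n t" if "t \<in> {0..real n}" for n t
    unfolding u_def using that by (intro agree) (auto simp: of_nat_ceiling)
  have "flow_on T u" for T
  proof -
    have "flow_on (real (nat \<lceil>T\<rceil>)) u"
      by (rule flow_on_cong[of _ "U (nat \<lceil>T\<rceil>)"]) (use u U in auto)
    then show ?thesis by (rule flow_on_subset) (rule of_nat_ceiling)
  qed
  moreover have "u 0 = u0" using U by (simp add: u_def)
  ultimately show ?thesis by blast
qed

end

section \<open>Well-posedness of the constrained flow\<close>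

theorem proposition3p4:
  fixes G :: "real^'d \<Rightarrow> real^'k"
    and Res :: "real^'d \<Rightarrow> real^'d \<Rightarrow> real^'k"
    and y :: "real^'k"
    and \<Gamma> :: "real^'k^'k"
    and C0 :: "real^'d^'d"
    and h :: "'m::finite \<Rightarrow> real^'d \<Rightarrow> real"
    and \<rho> :: "real \<Rightarrow> real"
    and u0 :: "(real^'d)^'j"
    and c_lip b_res \<tau> c R C :: real
  assumes "CARD('j) \<ge> 2"
    and "c_lip > 0" and "loc_lipschitz c_lip G"
    and "\<And>x. G differentiable (at x)"
    and "\<And>x1 x2. G x1 = G x2 + frechet_derivative G (at x2) (x1 - x2) + Res x1 x2"
    and "\<And>x1 x2. norm (Res x1 x2) \<le> b_res * (norm (x1 - x2))\<^sup>2"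
    and "spd \<Gamma>" and "spd C0"
    and "\<And>i. convex_on UNIV (h i)" and "\<And>i. cont_diff (h i)"
    and "\<exists>u. \<forall>i. h i u < 0"
    and "\<tau> > 0"
    and "\<And>t. t \<ge> 0 \<Longrightarrow> 0 \<le> \<rho> t \<and> \<rho> t \<le> 1"
    and "(\<rho> \<longlongrightarrow> 1) at_top"
    and "continuous_on {0..} \<rho>"
    and "\<And>i. h i (ens_mean u0) < 0"
    and "c > 0" and "\<And>j. norm (u0 $ j) \<le> c"
    and "R > 0" and "feasible h \<subseteq> cball 0 R"
    and "C > 0" and "\<And>i u. u \<in> cball 0 R \<Longrightarrow> norm (grad (h i) u) \<le> C"
  shows "(\<forall>u. eki_solution G y \<Gamma> C0 h \<tau> \<rho> u0 u \<longrightarrow> (\<forall>t\<ge>0. ens_mean (u t) \<in> feasible h)) \<and>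
         (\<exists>u. eki_solution G y \<Gamma> C0 h \<tau> \<rho> u0 u \<and>
              (\<forall>t\<ge>0. \<forall>i. h i (ens_mean (u t)) \<noteq> 0) \<and>
              (\<forall>v. eki_solution G y \<Gamma> C0 h \<tau> \<rho> u0 v \<longrightarrow> (\<forall>t\<ge>0. v t = u t)))"
proof -
  have lip: "c_lip-lipschitz_on UNIV G"
    by (rule loc_lipschitz_imp_lipschitz[OF assms(3)]) (use assms(2) in simp)
  have "R \<ge> 0" using assms(19) by simp
  interpret constrained_eki G y \<Gamma> C0 h \<tau> R c_lip \<rho>
    by (rule constrained_eki.intro)
      (rule lip assms(7-10,12,13,15,20) \<open>R \<ge> 0\<close> | assumption)+
  have feasible_all: "h i (ens_mean (v t)) < 0"
    if "eki_solution G y \<Gamma> C0 h \<tau> \<rho> u0 v" "0 \<le> t" for v t i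
  proof -
    have v: "v 0 = u0" "flow_on t v" using that(1) by (simp_all add: eki_solution_iff_flow_on)
    show ?thesis
      by (rule flow_stays_feasible[OF v(2)]) (simp_all add: v(1) assms(16) that(2))
  qed
  from global_flow_exists[OF assms(16)] obtain u where "u 0 = u0 \<and> (\<forall>T. flow_on T u)" ..
  then have u: "eki_solution G y \<Gamma> C0 h \<tau> \<rho> u0 u" by (simp add: eki_solution_iff_flow_on)
  have "v t = u t" if v: "eki_solution G y \<Gamma> C0 h \<tau> \<rho> u0 v" and t: "0 \<le> t" for v t
  proof (rule flow_unique)
    show "flow_on t v" "flow_on t u" "v 0 = u 0"
      using u v by (simp_all add: eki_solution_iff_flow_on)
    show "h i (ens_mean (v s)) < 0" "h i (ens_mean (u s)) < 0" if "s \<in> {0..t}" for s i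
      using that feasible_all[OF v] feasible_all[OF u] by simp_all
  qed (use t in simp)
  then have "\<forall>v. eki_solution G y \<Gamma> C0 h \<tau> \<rho> u0 v \<longrightarrow> (\<forall>t\<ge>0. v t = u t)" by blast
  moreover have "\<forall>t\<ge>0. \<forall>i. h i (ens_mean (u t)) \<noteq> 0" using feasible_all[OF u] by (simp add: less_imp_neq)
  moreover have "\<forall>v. eki_solution G y \<Gamma> C0 h \<tau> \<rho> u0 v \<longrightarrow> (\<forall>t\<ge>0. ens_mean (v t) \<in> feasible h)"
    using feasible_all by (simp add: feasible_def less_imp_le)
  ultimately show ?thesis using u by (intro conjI exI[of _ u])
qed

end
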